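(* Let $N\ge1$ and suppose that $(a_n)_{n\ge0}$ (positive), $(b_n)_{n\ge0}$ (real) are $N$-periodically modulated Jacobi parameters (with respect to $N$-periodic sequences $\alpha_n>0$, $\beta_n\in\mathbb{R}$, $n\in\mathbb{Z}$) such that $\operatorname{tr}\mathfrak{X}_0(0)\in(-2,2)$. If $$\Big(\frac{a_{n-1}}{a_n}:n\in\mathbb{N}\Big),\quad\Big(\frac{b_n}{a_n}:n\in\mathbb{N}\Big),\quad\Big(\frac1{a_n}:n\in\mathbb{N}\Big)\in\mathcal{D}_1^N,$$ and Carleman's condition $\sum_{n\ge0}1/a_n=\infty$ is satisfied, then for each compact set $K\subset\mathbb{C}_\varsigma$, where $\varsigma=\operatorname{sign}(\operatorname{tr}\mathfrak{X}_0'(0))$, there are $M\ge1$ and a basis of generalized eigenvectors $\{u^+(z),u^-(z)\}$ associated with $z\in K$ which are continuous on $K$ and holomorphic on $\operatorname{int}(K)$, such that for each $i_0\in\mathbb{N}_0$ the limits $$\varphi_{i_0}^+=\lim_{k\to\infty}\frac{u^+_{kN+i_0}}{\prod_{M\le j<k}\lambda_j^+}\quad\text{and}\quad\varphi_{i_0}^-=\lim_{k\to\infty}\frac{u^-_{kN+i_0}}{\prod_{M\le j<k}\lambda_j^-}$$ exist uniformly on $K$, where $\lambda_j^\pm$ are the eigenvalues of $Y_j=X_{jN}$ specified in the context. Moreover, for all $z\in K$ and $i_0\in\{0,1,\dots,N-1\}$, $$|\varphi_{i_0}^+(z)|+|\varphi_{i_0+1}^+(z)|>0\quad\text{and}\quad|\varphi_{i_0}^-(z)|+|\varphi_{i_0+1}^-(z)|>0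 .$$
   Context: $\mathbb{C}_{1}$ and $\mathbb{C}_{-1}$ denote the open upper and lower half-planes. A sequence $(x_n)$ belongs to $\mathcal{D}_1^N$ if $\sum_n|x_{n+N}-x_n|<\infty$. The parameters are $N$-periodically modulated if $\frac{a_{n-1}}{a_n}-\frac{\alpha_{n-1}}{\alpha_n}\to0$, $\frac{b_n}{a_n}-\frac{\beta_n}{\alpha_n}\to0$ and $a_n\to\infty$. Put $\mathfrak{B}_j(x)=\begin{pmatrix}0&1\\-\frac{\alpha_{j-1}}{\alpha_j}&\frac{x-\beta_j}{\alpha_j}\end{pmatrix}$, $\mathfrak{X}_n=\mathfrak{B}_{n+N-1}\cdots\mathfrak{B}_n$ ($n\in\mathbb{Z}$); $B_j(x)=\begin{pmatrix}0&1\\-\frac{a_{j-1}}{a_j}&\frac{x-b_j}{a_j}\end{pmatrix}$ for $j\ge1$, $B_0(x)=\begin{pmatrix}0&1\\-\frac1{a_0}&\frac{x-b_0}{a_0}\end{pmatrix}$, $X_n=B_{n+N-1}\cdots B_n$. A generalized eigenvector associated with $z\in\mathbb{C}$ is a sequence $(u_n)_{n\ge0}$ such that for some $\eta\in\mathbb{C}^2\setminus\{0\}$ the vectors $\vec u_0=\eta$, $\vec u_n=(u_{n-1},u_n)^T$ ($n\ge1$) satisfy $\vec u_{n+1}=B_n(z)\vec u_n$ for all $n\ge0$. A basis means two linearly independent ones for each $z\in K$; continuity/holomorphy refers to each function $z\mapsto u_n^\pm(z)$. With $\sqrt{\cdot}$ the principal square root (argument in $(-\pi,\pi]$), let $\xi_\pm(w)=w\pm\sqrt{w-1}\sqrt{w+1}$,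 $w\in\mathbb{C}$ (so on $[-1,1]$, $\xi_+$ takes its boundary values from the upper half-plane). The eigenvalues of $Y_j(z)$ are $$\lambda_j^\pm(z)=\sqrt{\det Y_j(z)}\;\xi_\pm\Big(\frac{\operatorname{tr}Y_j(z)}{2\sqrt{\det Y_j(z)}}\Big).$$ *)

theory Defs
  imports "HOL-Complex_Analysis.Complex_Analysis"
begin

definition bounded_variation_step :: "nat \<Rightarrow> (nat \<Rightarrow> real) \<Rightarrow> bool" where
  "bounded_variation_step N x \<longleftrightarrow> summable (\<lambda>n. \<bar>x (n + N) - x n\<bar>)"

definition periodic_seq :: "nat \<Rightarrow> (int \<Rightarrow> real) \<Rightarrow> bool" where
  "periodic_seq N x \<longleftrightarrow> (\<forall>n. x (n + int N) = x n)"

definition periodically_modulated ::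
  "nat \<Rightarrow> (int \<Rightarrow> real) \<Rightarrow> (int \<Rightarrow> real) \<Rightarrow> (nat \<Rightarrow> real) \<Rightarrow> (nat \<Rightarrow> real) \<Rightarrow> bool" where
  "periodically_modulated N \<alpha> \<beta> a b \<longleftrightarrow>
     (\<forall>n. \<alpha> n > 0) \<and> periodic_seq N \<alpha> \<and> periodic_seq N \<beta> \<and>
     ((\<lambda>n. a n / a (Suc n) - \<alpha> (int n) / \<alpha> (int n + 1)) \<longlonglongrightarrow> 0) \<and>
     ((\<lambda>n. b n / a n - \<beta> (int n) / \<alpha> (int n)) \<longlonglongrightarrow> 0) \<and>
     filterlim a at_top sequentially"

text \<open>\<open>step_product B n k x\<close> is \<open>B\<^sub>n\<^sub>+\<^sub>k\<^sub>-\<^sub>1(x) \<cdots> B\<^sub>n(x)\<close>, latest factor on the left.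
  The index type is \<^typ>\<open>int\<close> for the periodic matrices and \<^typ>\<open>nat\<close> for the Jacobi ones.\<close>

primrec step_product ::
  "('i::semiring_1 \<Rightarrow> 'f::semiring_1 \<Rightarrow> 'f^2^2) \<Rightarrow> 'i \<Rightarrow> nat \<Rightarrow> 'f \<Rightarrow> 'f^2^2" where
  "step_product B n 0 x = mat 1"
| "step_product B n (Suc k) x = B (n + of_nat k) x ** step_product B n k x"

definition periodic_transfer ::
  "(int \<Rightarrow> real) \<Rightarrow> (int \<Rightarrow> real) \<Rightarrow> int \<Rightarrow> real \<Rightarrow> real^2^2" where
  "periodic_transfer \<alpha> \<beta> j x =
     vector [vector [0, 1], vector [- (\<alpha> (j - 1) / \<alpha> j), (x - \<beta> j) / \<alpha> j]]"

definition periodic_monodromy ::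
  "nat \<Rightarrow> (int \<Rightarrow> real) \<Rightarrow> (int \<Rightarrow> real) \<Rightarrow> int \<Rightarrow> real \<Rightarrow> real^2^2" where
  "periodic_monodromy N \<alpha> \<beta> n = step_product (periodic_transfer \<alpha> \<beta>) n N"

definition transfer ::
  "(nat \<Rightarrow> real) \<Rightarrow> (nat \<Rightarrow> real) \<Rightarrow> nat \<Rightarrow> complex \<Rightarrow> complex^2^2" where
  "transfer a b j z =
     vector [vector [0, 1],
             vector [- (of_real (if j = 0 then 1 else a (j - 1)) / of_real (a j)),
                     (z - of_real (b j)) / of_real (a j)]]"

definition monodromy ::
  "nat \<Rightarrow> (nat \<Rightarrow> real) \<Rightarrow> (nat \<Rightarrow> real) \<Rightarrow> nat \<Rightarrow> complex \<Rightarrow> complex^2^2" where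
  "monodromy N a b n = step_product (transfer a b) n N"

definition half_plane :: "real \<Rightarrow> complex set" where
  "half_plane s = {z. 0 < s * Im z}"

definition gen_eigenvector ::
  "(nat \<Rightarrow> real) \<Rightarrow> (nat \<Rightarrow> real) \<Rightarrow> complex \<Rightarrow> (nat \<Rightarrow> complex) \<Rightarrow> bool" where
  "gen_eigenvector a b z u \<longleftrightarrow>
     (\<exists>\<eta>::complex^2. \<eta> \<noteq> 0 \<and>
       (let v = (\<lambda>n. if n = 0 then \<eta> else vector [u (n - 1), u n])
        in \<forall>n. v (Suc n) = transfer a b n z *v v n))"

definition lin_indep_pair :: "(nat \<Rightarrow> complex) \<Rightarrow> (nat \<Rightarrow> complex) \<Rightarrow> bool" where
  "lin_indep_pair u v \<longleftrightarrow> (\<forall>c d. (\<forall>n. c * u n + d * v n = 0) \<longrightarrow> c = 0 \<and> d = 0)"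

definition gen_eigenvector_basis ::
  "(nat \<Rightarrow> real) \<Rightarrow> (nat \<Rightarrow> real) \<Rightarrow> complex \<Rightarrow> (nat \<Rightarrow> complex) \<Rightarrow> (nat \<Rightarrow> complex) \<Rightarrow> bool" where
  "gen_eigenvector_basis a b z u v \<longleftrightarrow>
     gen_eigenvector a b z u \<and> gen_eigenvector a b z v \<and> lin_indep_pair u v"

definition xi_plus :: "complex \<Rightarrow> complex" where
  "xi_plus w = w + csqrt (w - 1) * csqrt (w + 1)"

definition xi_minus :: "complex \<Rightarrow> complex" where
  "xi_minus w = w - csqrt (w - 1) * csqrt (w + 1)"

definition eig_plus :: "complex^2^2 \<Rightarrow> complex" where
  "eig_plus Y = csqrt (det Y) * xi_plus (trace Y / (2 * csqrt (det Y)))"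

definition eig_minus :: "complex^2^2 \<Rightarrow> complex" where
  "eig_minus Y = csqrt (det Y) * xi_minus (trace Y / (2 * csqrt (det Y)))"

end

theory Submission
  imports Defs
begin

text \<open>
  The proof diagonalizes the block recurrence \<open>x\<^sub>j\<^sub>+\<^sub>1 = Y\<^sub>j x\<^sub>j\<close> and controls the result as in
  Levinson's theorem on asymptotically diagonal systems. The entries of \<open>Y\<^sub>j\<close> have uniformly bounded
  variation on bounded sets and tend to those of the real matrix \<open>\<XX>\<^sub>0(0)\<close>, which has
  determinant \<open>1\<close> and non-real eigenvalues. Bounded variation passes to the eigenvalues and to the
  slopes of the eigenlines (\<open>uniformly_bv_square_root\<close> handles the square root of the
  discriminant). In the moving eigenbasis the recurrence is therefore diagonal up to errors that are
  summable, uniformly in \<open>z\<close>.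

  Such errors are harmless if one eigenvalue dominates the other. This is where the half-plane
  enters. The limit is real, so the imaginary part of the trace of \<open>Y\<^sub>j(z)\<close> comes from
  the term of first order in \<open>z\<close>: it is asymptotically a positive multiple of
  \<open>tr \<XX>\<^sub>0'(0) Im z / a\<^sub>j\<^sub>N\<close> (\<open>Im_trace_limit\<close>). On the half-plane in question it is positive
  for large \<open>j\<close>, and the quotient of the moduli of the two eigenvalues is at most
  \<open>1 - c / a\<^sub>j\<^sub>N\<close> (\<open>eigenvalue_ratio\<close>).

  The dominant solution is obtained by forward iteration; its component along the other eigenline
  dies out because Carleman's condition makes the product of the quotients tend to \<open>0\<close>
  (\<open>dominant_solution\<close>). The recessive solution is obtained by iterating backward from infinity
  (\<open>recessive_solution\<close>). Both constructions are uniform in \<open>z\<close> and yield holomorphic solutions. The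
  limits inside a block follow from the three-term recurrence, whose coefficients converge along each
  residue class (\<open>limits_along_residue_classes\<close>).
\<close>

(* Otherwise the dollar sign, used below for components of vectors, would also be read as a
   coefficient of a formal power series. *)
no_notation fps_nth (infixl \<open>$\<close> 75)

section \<open>Families of uniformly bounded variation\<close>

text \<open>
  The limit is a constant because all families that occur here lose their dependence on the
  spectral parameter: \<open>z\<close> enters only through \<open>z / a\<^sub>n\<close>, and \<open>a\<^sub>n\<close> tends to infinity.
  A constant limit is bounded, and bounded away from \<open>0\<close> if it is nonzero; this makes the class
  closed under products and quotients.
\<close>

definition uniformly_bv :: "'a set \<Rightarrow> (nat \<Rightarrow> 'a \<Rightarrow> complex) \<Rightarrow> complex \<Rightarrow> bool" where
  "uniformly_bv U f l \<longleftrightarrow> uniform_limit U f (\<lambda>_. l) sequentially \<and>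
     (\<exists>g. summable g \<and> (\<forall>\<^sub>F j in sequentially. \<forall>z\<in>U. cmod (f (Suc j) z - f j z) \<le> g j))"

lemma uniformly_bvI:
  assumes "uniform_limit U f (\<lambda>_. l) sequentially" "summable g"
    and "\<forall>\<^sub>F j in sequentially. \<forall>z\<in>U. cmod (f (Suc j) z - f j z) \<le> g j"
  shows "uniformly_bv U f l"
  using assms unfolding uniformly_bv_def by blast

lemma uniformly_bvE:
  assumes "uniformly_bv U f l"
  obtains g where "uniform_limit U f (\<lambda>_. l) sequentially" "summable g"
    "\<forall>\<^sub>F j in sequentially. \<forall>z\<in>U. cmod (f (Suc j) z - f j z) \<le> g j"
  using assms unfolding uniformly_bv_def by blast

lemma uniformly_bv_limit: "uniformly_bv U f l \<Longrightarrow> uniform_limit U f (\<lambda>_. l) sequentially"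
  unfolding uniformly_bv_def by blast

lemma uniform_limit_dist_less:
  assumes "uniform_limit U f (\<lambda>_. l) sequentially" "e > 0"
  shows "\<forall>\<^sub>F j in sequentially. \<forall>z\<in>U. dist (f j z) l < e"
  using uniform_limitD[OF assms] by simp

lemma uniform_limit_norm_bound:
  fixes l :: complex
  assumes "uniform_limit U f (\<lambda>_. l) sequentially"
  shows "\<forall>\<^sub>F j in sequentially. \<forall>z\<in>U. cmod (f j z) \<le> cmod l + 1"
  using uniform_limit_dist_less[OF assms zero_less_one]
proof eventually_elim
  case (elim j)
  show ?case
  proof
    fix z assume "z \<in> U"
    with elim have "dist (f j z) l < 1" by blast
    then show "cmod (f j z) \<le> cmod l + 1"
      using norm_triangle_ineq2[of "f j z" l] by (simp add: dist_norm)
  qed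
qed

lemma eventually_Suc: "eventually P sequentially \<Longrightarrow> \<forall>\<^sub>F j in sequentially. P (Suc j)"
  by (rule eventually_sequentially_Suc[THEN iffD2])

lemma uniformly_bv_cong:
  assumes "uniformly_bv U f l" "\<forall>\<^sub>F j in sequentially. \<forall>z\<in>U. f j z = f' j z"
  shows "uniformly_bv U f' l"
proof -
  obtain g where g: "uniform_limit U f (\<lambda>_. l) sequentially" "summable g"
    "\<forall>\<^sub>F j in sequentially. \<forall>z\<in>U. cmod (f (Suc j) z - f j z) \<le> g j"
    using uniformly_bvE[OF assms(1)] .
  have "\<forall>\<^sub>F j in sequentially. \<forall>z\<in>U. f (Suc j) z = f' (Suc j) z"
    using eventually_Suc[OF assms(2)] .
  with g(3) assms(2) have "\<forall>\<^sub>F j in sequentially. \<forall>z\<in>U. cmod (f' (Suc j) z - f' j z) \<le> g j"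
    by eventually_elim auto
  moreover have "uniform_limit U f' (\<lambda>_. l) sequentially"
    using g(1) assms(2) by (subst uniform_limit_cong[where g = f and i = "\<lambda>_. l"])
      (auto elim!: eventually_mono)
  ultimately show ?thesis using g(2) by (intro uniformly_bvI)
qed

lemma uniformly_bv_const: "uniformly_bv U (\<lambda>_ _. c) c"
  by (rule uniformly_bvI[where g = "\<lambda>_. 0"]) (auto intro: uniform_limit_const)

lemma uniform_limit_of_tendsto:
  fixes l :: "'b::metric_space"
  assumes "x \<longlonglongrightarrow> l"
  shows "uniform_limit U (\<lambda>j _. x j) (\<lambda>_. l) sequentially"
  using assms unfolding uniform_limit_iff by (auto elim!: eventually_mono dest: tendstoD)

lemma uniformly_bv_of_real:
  assumes "x \<longlonglongrightarrow> l" "summable (\<lambda>j. \<bar>x (Suc j) - x j\<bar>)"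
  shows "uniformly_bv U (\<lambda>j _. complex_of_real (x j)) (of_real l)"
proof (rule uniformly_bvI)
  show "uniform_limit U (\<lambda>j _. complex_of_real (x j)) (\<lambda>_. complex_of_real l) sequentially"
    using assms(1) by (intro uniform_limit_of_tendsto tendsto_of_real)
  show "summable (\<lambda>j. \<bar>x (Suc j) - x j\<bar>)" by fact
qed (auto simp flip: of_real_diff)

lemma uniformly_bv_add:
  assumes "uniformly_bv U f k" "uniformly_bv U g l"
  shows "uniformly_bv U (\<lambda>j z. f j z + g j z) (k + l)"
proof -
  obtain F where F: "uniform_limit U f (\<lambda>_. k) sequentially" "summable F"
    "\<forall>\<^sub>F j in sequentially. \<forall>z\<in>U. cmod (f (Suc j) z - f j z) \<le> F j"
    using uniformly_bvE[OF assms(1)] .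
  obtain G where G: "uniform_limit U g (\<lambda>_. l) sequentially" "summable G"
    "\<forall>\<^sub>F j in sequentially. \<forall>z\<in>U. cmod (g (Suc j) z - g j z) \<le> G j"
    using uniformly_bvE[OF assms(2)] .
  show ?thesis
  proof (rule uniformly_bvI)
    show "uniform_limit U (\<lambda>j z. f j z + g j z) (\<lambda>_. k + l) sequentially"
      by (intro uniform_limit_intros F G)
    show "summable (\<lambda>j. F j + G j)" by (intro summable_add F G)
    show "\<forall>\<^sub>F j in sequentially. \<forall>z\<in>U.
        cmod (f (Suc j) z + g (Suc j) z - (f j z + g j z)) \<le> F j + G j"
      using F(3) G(3)
    proof eventually_elim
      case (elim j)
      show ?case
      proof
        fix z assume "z \<in> U"
        then have "cmod ((f (Suc j) z - f j z) + (g (Suc j) z - g j z)) \<le> F j + G j"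
          using elim by (intro norm_triangle_mono) auto
        then show "cmod (f (Suc j) z + g (Suc j) z - (f j z + g j z)) \<le> F j + G j"
          by (simp add: algebra_simps)
      qed
    qed
  qed
qed

lemma uniformly_bv_mult:
  assumes "uniformly_bv U f k" "uniformly_bv U g l"
  shows "uniformly_bv U (\<lambda>j z. f j z * g j z) (k * l)"
proof -
  obtain F where F: "uniform_limit U f (\<lambda>_. k) sequentially" "summable F"
    "\<forall>\<^sub>F j in sequentially. \<forall>z\<in>U. cmod (f (Suc j) z - f j z) \<le> F j"
    using uniformly_bvE[OF assms(1)] .
  obtain G where G: "uniform_limit U g (\<lambda>_. l) sequentially" "summable G"
    "\<forall>\<^sub>F j in sequentially. \<forall>z\<in>U. cmod (g (Suc j) z - g j z) \<le> G j"
    using uniformly_bvE[OF assms(2)] .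
  have g_Suc: "\<forall>\<^sub>F j in sequentially. \<forall>z\<in>U. cmod (g (Suc j) z) \<le> cmod l + 1"
    using eventually_Suc[OF uniform_limit_norm_bound[OF G(1)]] .
  show ?thesis
  proof (rule uniformly_bvI)
    show "uniform_limit U (\<lambda>j z. f j z * g j z) (\<lambda>_. k * l) sequentially"
      using F G by (intro uniform_lim_mult) (auto simp: image_constant_conv)
    show "summable (\<lambda>j. F j * (cmod l + 1) + (cmod k + 1) * G j)"
      by (intro summable_add summable_mult summable_mult2 F G)
    show "\<forall>\<^sub>F j in sequentially. \<forall>z\<in>U.
        cmod (f (Suc j) z * g (Suc j) z - f j z * g j z) \<le> F j * (cmod l + 1) + (cmod k + 1) * G j"
      using F(3) G(3) g_Suc uniform_limit_norm_bound[OF F(1)]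
    proof eventually_elim
      case (elim j)
      show ?case
      proof
        fix z assume z: "z \<in> U"
        have "F j \<ge> 0" "G j \<ge> 0"
          using elim z by (meson norm_ge_zero order_trans)+
        then have "cmod ((f (Suc j) z - f j z) * g (Suc j) z + f j z * (g (Suc j) z - g j z))
            \<le> F j * (cmod l + 1) + (cmod k + 1) * G j"
          unfolding norm_mult using elim z
          by (intro norm_triangle_mono) (auto simp: norm_mult intro!: mult_mono)
        then show "cmod (f (Suc j) z * g (Suc j) z - f j z * g j z)
            \<le> F j * (cmod l + 1) + (cmod k + 1) * G j"
          by (simp add: algebra_simps)
      qed
    qed
  qed
qed

lemma uniformly_bv_uminus: "uniformly_bv U f k \<Longrightarrow> uniformly_bv U (\<lambda>j z. - f j z) (- k)"
  using uniformly_bv_mult[OF uniformly_bv_const[of U "-1"]] by simp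

lemma uniformly_bv_diff:
  "uniformly_bv U f k \<Longrightarrow> uniformly_bv U g l \<Longrightarrow> uniformly_bv U (\<lambda>j z. f j z - g j z) (k - l)"
  using uniformly_bv_add[OF _ uniformly_bv_uminus] by simp

lemma uniform_limit_norm_lower_bound:
  fixes l :: complex
  assumes "uniform_limit U f (\<lambda>_. l) sequentially" "l \<noteq> 0"
  shows "\<forall>\<^sub>F j in sequentially. \<forall>z\<in>U. cmod l / 2 \<le> cmod (f j z)"
proof -
  have "cmod l / 2 > 0" using assms(2) by simp
  from uniform_limit_dist_less[OF assms(1) this] show ?thesis
  proof eventually_elim
    case (elim j)
    show ?case
    proof
      fix z assume "z \<in> U"
      with elim have "dist (f j z) l < cmod l / 2" by blast
      then show "cmod l / 2 \<le> cmod (f j z)"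
        using norm_triangle_ineq2[of l "f j z"] by (simp add: dist_norm norm_minus_commute)
    qed
  qed
qed

lemma uniformly_bv_inverse:
  assumes "uniformly_bv U f l" "l \<noteq> 0"
  shows "uniformly_bv U (\<lambda>j z. inverse (f j z)) (inverse l)"
proof -
  obtain F where F: "uniform_limit U f (\<lambda>_. l) sequentially" "summable F"
    "\<forall>\<^sub>F j in sequentially. \<forall>z\<in>U. cmod (f (Suc j) z - f j z) \<le> F j"
    using uniformly_bvE[OF assms(1)] .
  define c where "c = cmod l / 2"
  have c: "c > 0" using assms(2) by (simp add: c_def)
  have lower: "\<forall>\<^sub>F j in sequentially. \<forall>z\<in>U. c \<le> cmod (f j z)"
    unfolding c_def by (rule uniform_limit_norm_lower_bound[OF F(1) assms(2)])
  have lower_Suc: "\<forall>\<^sub>F j in sequentially. \<forall>z\<in>U. c \<le> cmod (f (Suc j) z)"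
    using eventually_Suc[OF lower] .
  show ?thesis
  proof (rule uniformly_bvI)
    show "uniform_limit U (\<lambda>j z. inverse (f j z)) (\<lambda>_. inverse l) sequentially"
      using uniform_lim_inverse[OF F(1), of "cmod l"] assms(2) by (simp add: o_def)
    show "summable (\<lambda>j. F j / (c * c))" by (intro summable_divide F)
    show "\<forall>\<^sub>F j in sequentially. \<forall>z\<in>U. cmod (inverse (f (Suc j) z) - inverse (f j z)) \<le> F j / (c * c)"
      using F(3) lower lower_Suc
    proof eventually_elim
      case (elim j)
      show ?case
      proof
        fix z assume z: "z \<in> U"
        have ne: "f j z \<noteq> 0" "f (Suc j) z \<noteq> 0" using elim z c by force+
        have "cmod (inverse (f (Suc j) z) - inverse (f j z))
            = cmod (f (Suc j) z - f j z) / (cmod (f (Suc j) z) * cmod (f j z))"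
          using ne by (simp add: norm_mult norm_divide divide_simps norm_minus_commute)
        also have "\<dots> \<le> F j / (c * c)"
          using elim z c by (intro frac_le mult_mono) (auto intro: order_trans[OF norm_ge_zero])
        finally show "cmod (inverse (f (Suc j) z) - inverse (f j z)) \<le> F j / (c * c)" .
      qed
    qed
  qed
qed

lemma uniformly_bv_divide:
  "uniformly_bv U f k \<Longrightarrow> uniformly_bv U g l \<Longrightarrow> l \<noteq> 0 \<Longrightarrow> uniformly_bv U (\<lambda>j z. f j z / g j z) (k / l)"
  using uniformly_bv_mult[OF _ uniformly_bv_inverse] by (simp add: divide_inverse)

text \<open>A square root taken in the upper half-plane inherits bounded variation when the radicand
  tends to a negative number: for \<open>x\<close> and \<open>y\<close> above the real axis \<open>\<bar>x + y\<bar>\<close> is at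
  least \<open>Im x + Im y\<close>, so that \<open>x - y = (x\<^sup>2 - y\<^sup>2) / (x + y)\<close> is controlled.\<close>

lemma uniformly_bv_square_root:
  fixes \<kappa> :: real
  assumes bv: "uniformly_bv U (\<lambda>j z. (f j z)\<^sup>2) (- of_real (\<kappa>\<^sup>2))" and \<kappa>: "\<kappa> > 0"
    and Im: "\<forall>\<^sub>F j in sequentially. \<forall>z\<in>U. Im (f j z) \<ge> 0"
  shows "uniformly_bv U f (\<i> * of_real \<kappa>)"
proof -
  obtain F where F: "uniform_limit U (\<lambda>j z. (f j z)\<^sup>2) (\<lambda>_. - of_real (\<kappa>\<^sup>2)) sequentially" "summable F"
    "\<forall>\<^sub>F j in sequentially. \<forall>z\<in>U. cmod ((f (Suc j) z)\<^sup>2 - (f j z)\<^sup>2) \<le> F j"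
    using uniformly_bvE[OF bv] .
  have diff_le: "cmod (x - y) \<le> cmod (x\<^sup>2 - y\<^sup>2) / c" if "Im x + Im y \<ge> c" "c > 0" for x y :: complex and c
  proof -
    have "cmod (x\<^sup>2 - y\<^sup>2) = cmod (x - y) * cmod (x + y)"
      by (simp add: norm_mult[symmetric] power2_eq_square algebra_simps)
    also have "\<dots> \<ge> cmod (x - y) * c"
      using that abs_Im_le_cmod[of "x + y"] by (intro mult_left_mono) auto
    finally show ?thesis using that by (simp add: field_simps)
  qed
  have lim: "uniform_limit U f (\<lambda>_. \<i> * of_real \<kappa>) sequentially"
  proof (rule uniform_limitI)
    fix e :: real assume "e > 0"
    then have "e * \<kappa> > 0" using \<kappa> by simp
    from uniform_limit_dist_less[OF F(1) this] Im
    show "\<forall>\<^sub>F j in sequentially. \<forall>z\<in>U. dist (f j z) (\<i> * of_real \<kappa>) < e"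
    proof eventually_elim
      case (elim j)
      show ?case
      proof
        fix z assume z: "z \<in> U"
        have "cmod (f j z - \<i> * of_real \<kappa>) \<le> cmod ((f j z)\<^sup>2 - (\<i> * of_real \<kappa>)\<^sup>2) / \<kappa>"
          using elim z \<kappa> by (intro diff_le) auto
        also have "\<dots> < e" using elim z \<kappa> by (simp add: dist_norm power_mult_distrib field_simps)
        finally show "dist (f j z) (\<i> * of_real \<kappa>) < e" by (simp add: dist_norm)
      qed
    qed
  qed
  have half: "\<forall>\<^sub>F j in sequentially. \<forall>z\<in>U. Im (f j z) \<ge> \<kappa> / 2"
  proof -
    have "\<kappa> / 2 > 0" using \<kappa> by simp
    from uniform_limit_dist_less[OF lim this] show ?thesis
    proof eventually_elim
      case (elim j)
      show ?case
      proof
        fix z assume "z \<in> U"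
        with elim have "cmod (f j z - \<i> * of_real \<kappa>) < \<kappa> / 2" by (auto simp: dist_norm)
        then show "Im (f j z) \<ge> \<kappa> / 2" using abs_Im_le_cmod[of "f j z - \<i> * of_real \<kappa>"] by simp
      qed
    qed
  qed
  have half_Suc: "\<forall>\<^sub>F j in sequentially. \<forall>z\<in>U. Im (f (Suc j) z) \<ge> \<kappa> / 2"
    using eventually_Suc[OF half] .
  show ?thesis
  proof (rule uniformly_bvI[OF lim])
    show "summable (\<lambda>j. F j / \<kappa>)" by (intro summable_divide F)
    show "\<forall>\<^sub>F j in sequentially. \<forall>z\<in>U. cmod (f (Suc j) z - f j z) \<le> F j / \<kappa>"
      using F(3) half half_Suc
    proof eventually_elim
      case (elim j)
      show ?case
      proof
        fix z assume z: "z \<in> U"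
        have "Im (f (Suc j) z) \<ge> \<kappa> / 2" "Im (f j z) \<ge> \<kappa> / 2" using elim z by auto
        then have "cmod (f (Suc j) z - f j z) \<le> cmod ((f (Suc j) z)\<^sup>2 - (f j z)\<^sup>2) / \<kappa>"
          using \<kappa> by (intro diff_le) auto
        also have "\<dots> \<le> F j / \<kappa>" using elim z \<kappa> by (simp add: divide_right_mono)
        finally show "cmod (f (Suc j) z - f j z) \<le> F j / \<kappa>" .
      qed
    qed
  qed
qed

section \<open>Perturbed diagonal systems\<close>

text \<open>
  The threshold \<open>1/8\<close> keeps the accumulated growth \<open>exp (2 * 1/8)\<close> below \<open>2\<close>. It reappears wherever a
  perturbation has to be small enough for a limit to stay away from \<open>0\<close>.
\<close>

lemma prod_one_plus_le:
  fixes e :: "nat \<Rightarrow> real"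
  assumes "\<And>j. e j \<ge> 0" "summable e" "suminf e \<le> 1/8"
  shows "(\<Prod>i<m. 1 + 2 * e (j + i)) \<le> 2"
proof -
  have "(\<Prod>i<m. 1 + 2 * e (j + i)) \<le> (\<Prod>i<m. exp (2 * e (j + i)))"
    using assms(1) by (intro prod_mono) (auto intro: add_nonneg_nonneg)
  also have "\<dots> = exp (2 * (\<Sum>i<m. e (j + i)))"
    by (simp add: exp_sum sum_distrib_left)
  also have "(\<Sum>i<m. e (j + i)) = sum e {j..<j + m}"
    using sum.shift_bounds_nat_ivl[of e 0 j m] by (simp add: lessThan_atLeast0 add.commute)
  also have "\<dots> \<le> suminf e"
    using assms by (intro sum_le_suminf) auto
  also have "exp (2 * suminf e) \<le> exp (1/4)" using assms(3) by simp
  also have "exp (1/4 :: real) \<le> 2"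
    using exp_bound[of "1/4"] by (simp add: power2_eq_square)
  finally show ?thesis using assms by simp
qed

text \<open>
  Each step forgets a fraction \<open>\<delta> n\<close> of the past. The contribution of everything before a time \<open>m\<close>
  is damped by \<open>exp (- \<Sum> \<delta>)\<close>, which tends to \<open>0\<close> since \<open>\<delta>\<close> is not summable, while the inputs
  after \<open>m\<close> contribute at most a tail of \<open>\<Sum> g\<close>.
\<close>

lemma contracting_sequence_tendsto_0:
  fixes t g \<delta> :: "nat \<Rightarrow> real"
  assumes step: "\<And>n. t (Suc n) = (1 - \<delta> n) * t n + g n" and t0: "t 0 \<ge> 0"
    and \<delta>: "\<And>n. 0 \<le> \<delta> n" "\<And>n. \<delta> n \<le> 1" "\<not> summable \<delta>"
    and g: "\<And>n. g n \<ge> 0" "summable g"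
  shows "t \<longlonglongrightarrow> 0"
proof (rule LIMSEQ_I)
  fix \<epsilon> :: real assume "\<epsilon> > 0"
  have t_nonneg: "t n \<ge> 0" for n
    using t0 g \<delta> by (induction n) (auto simp: step)
  obtain m where m: "norm (\<Sum>i. g (i + m)) < \<epsilon> / 2"
    using suminf_exist_split[of "\<epsilon> / 2" g] \<open>\<epsilon> > 0\<close> g(2) by auto
  have bound: "t (m + k) \<le> exp (- (\<Sum>i<k. \<delta> (m + i))) * t m + (\<Sum>i<k. g (i + m))" for k
  proof (induction k)
    case (Suc k)
    have "t (m + Suc k) = (1 - \<delta> (m + k)) * t (m + k) + g (m + k)" by (simp add: step)
    also have "(1 - \<delta> (m + k)) * t (m + k)
        \<le> (1 - \<delta> (m + k)) * (exp (- (\<Sum>i<k. \<delta> (m + i))) * t m + (\<Sum>i<k. g (i + m)))"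
      using Suc \<delta> by (intro mult_left_mono) auto
    also have "\<dots> = (1 - \<delta> (m + k)) * (exp (- (\<Sum>i<k. \<delta> (m + i))) * t m)
          + (1 - \<delta> (m + k)) * (\<Sum>i<k. g (i + m))"
      by (simp add: algebra_simps)
    also have "(1 - \<delta> (m + k)) * (exp (- (\<Sum>i<k. \<delta> (m + i))) * t m)
        \<le> exp (- \<delta> (m + k)) * (exp (- (\<Sum>i<k. \<delta> (m + i))) * t m)"
      using t_nonneg[of m] exp_ge_add_one_self[of "- \<delta> (m + k)"] by (intro mult_right_mono) auto
    also have "\<dots> = exp (- (\<Sum>i<Suc k. \<delta> (m + i))) * t m"
      by (simp add: exp_add[symmetric] mult.assoc[symmetric])
    also have "(1 - \<delta> (m + k)) * (\<Sum>i<k. g (i + m)) \<le> 1 * (\<Sum>i<k. g (i + m))"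
      using g(1) \<delta>(1) by (intro mult_right_mono sum_nonneg) auto
    finally show ?case by (simp add: add.commute)
  qed simp
  have "filterlim (\<lambda>k. \<Sum>i<k. \<delta> (i + m)) at_top sequentially"
  proof -
    have ns: "\<not> summable (\<lambda>i. \<delta> (i + m))" using \<delta>(3) by (simp add: summable_iff_shift)
    have "\<exists>k. Z \<le> (\<Sum>i<k. \<delta> (i + m))" for Z
    proof (rule ccontr)
      assume "\<not> ?thesis"
      then have "summable (\<lambda>i. \<delta> (i + m))"
        using \<delta>(1) by (intro summableI_nonneg_bounded[of _ Z]) (auto simp: not_le less_imp_le)
      with ns show False by blast
    qed
    then show ?thesis
      unfolding filterlim_at_top eventually_sequentially
    proof (intro allI)
      fix Z
      obtain k where k: "Z \<le> (\<Sum>i<k. \<delta> (i + m))" using \<open>\<And>Z. \<exists>k. Z \<le> (\<Sum>i<k. \<delta> (i + m))\<close> by blast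
      have "(\<Sum>i<k. \<delta> (i + m)) \<le> (\<Sum>i<n. \<delta> (i + m))" if "n \<ge> k" for n
        using that \<delta>(1) by (intro sum_mono2) auto
      with k show "\<exists>N. \<forall>n\<ge>N. Z \<le> (\<Sum>i<n. \<delta> (i + m))" by (meson order_trans)
    qed
  qed
  then have "((\<lambda>k. exp (- (\<Sum>i<k. \<delta> (i + m)))) \<longlongrightarrow> 0) sequentially"
    by (intro filterlim_compose[OF exp_at_bot] filterlim_compose[OF filterlim_uminus_at_bot_at_top])
  then have "(\<lambda>k. exp (- (\<Sum>i<k. \<delta> (i + m))) * t m) \<longlonglongrightarrow> 0"
    by (auto intro: tendsto_mult_left_zero)
  then obtain K where K: "\<And>k. k \<ge> K \<Longrightarrow> exp (- (\<Sum>i<k. \<delta> (i + m))) * t m < \<epsilon> / 2"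
    using LIMSEQ_D[of "\<lambda>k. exp (- (\<Sum>i<k. \<delta> (i + m))) * t m" 0 "\<epsilon> / 2"] \<open>\<epsilon> > 0\<close> t_nonneg[of m]
    by auto
  show "\<exists>no. \<forall>n\<ge>no. norm (t n - 0) < \<epsilon>"
  proof (intro exI allI impI)
    fix n assume n: "n \<ge> m + K"
    define k where "k = n - m"
    have k: "n = m + k" "k \<ge> K" using n by (auto simp: k_def)
    have "(\<Sum>i<k. g (i + m)) \<le> (\<Sum>i. g (i + m))"
      using g by (intro sum_le_suminf summable_ignore_initial_segment) auto
    then show "norm (t n - 0) < \<epsilon>"
      using bound[of k] K[of k] k m t_nonneg[of n] by (simp add: add.commute)
  qed
qed

text \<open>
  In coordinates with respect to the moving eigenbasis, and divided by the product of the
  dominant eigenvalues, the recurrence becomes \<open>diag(1, q j)\<close> up to summable errors. The first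
  coordinate then has a summable variation, so it converges and stays close to its initial
  value \<open>1\<close>. The second one satisfies a recurrence with contraction factor \<open>1 - \<delta> j\<close> and summable
  input, and divergence of \<open>\<Sum> \<delta>\<close> forces it to \<open>0\<close>.
\<close>

lemma dominant_solution:
  fixes x y q A B :: "nat \<Rightarrow> 'a \<Rightarrow> complex" and e \<delta> :: "nat \<Rightarrow> real"
  assumes e: "\<And>j. e j \<ge> 0" "summable e" "suminf e \<le> 1/8"
    and \<delta>: "\<And>j. 0 \<le> \<delta> j" "\<And>n. \<delta> n \<le> 1" "\<not> summable \<delta>"
    and q: "\<And>j z. z \<in> U \<Longrightarrow> cmod (q j z) \<le> 1 - \<delta> j"
    and A: "\<And>j z. z \<in> U \<Longrightarrow> cmod (A j z) \<le> e j"
    and B: "\<And>j z. z \<in> U \<Longrightarrow> cmod (B j z) \<le> e j"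
    and init: "\<And>z. z \<in> U \<Longrightarrow> x 0 z = 1" "\<And>z. z \<in> U \<Longrightarrow> y 0 z = 0"
    and x_Suc: "\<And>j z. z \<in> U \<Longrightarrow> x (Suc j) z = x j z - (A j z * x j z + B j z * (q j z * y j z))"
    and y_Suc: "\<And>j z. z \<in> U \<Longrightarrow> y (Suc j) z = q j z * y j z + (A j z * x j z + B j z * (q j z * y j z))"
  shows "\<exists>\<phi>. uniform_limit U x \<phi> sequentially \<and> (\<forall>z\<in>U. cmod (\<phi> z - 1) \<le> 1/4) \<and>
    uniform_limit U y (\<lambda>_. 0) sequentially"
proof -
  define \<rho> where "\<rho> j z = A j z * x j z + B j z * (q j z * y j z)" for j z
  have qy: "cmod (q j z * y j z) \<le> (1 - \<delta> j) * cmod (y j z)" if "z \<in> U" for j z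
    using q[OF that] by (simp add: norm_mult mult_right_mono)
  have qy': "cmod (q j z * y j z) \<le> cmod (y j z)" if "z \<in> U" for j z
    using qy[OF that, of j] mult_right_mono[of "1 - \<delta> j" 1 "cmod (y j z)"] \<delta>(1)[of j] by simp
  have \<rho>: "cmod (\<rho> j z) \<le> e j * (cmod (x j z) + cmod (y j z))" if z: "z \<in> U" for j z
  proof -
    have "cmod (\<rho> j z) \<le> e j * cmod (x j z) + e j * cmod (y j z)"
      unfolding \<rho>_def
      using mult_mono[OF A[OF z, of j] order_refl[of "cmod (x j z)"]] mult_mono[OF B[OF z, of j] qy'[OF z, of j]] e(1)[of j]
      by (intro norm_triangle_mono) (auto simp: norm_mult)
    then show ?thesis by (simp add: distrib_left)
  qed
  have growth: "cmod (x j z) + cmod (y j z) \<le> (\<Prod>i<j. 1 + 2 * e (0 + i))" if z: "z \<in> U" for j z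
  proof (induction j)
    case (Suc j)
    have "cmod (x (Suc j) z) \<le> cmod (x j z) + cmod (\<rho> j z)"
      unfolding x_Suc[OF z] \<rho>_def by (rule norm_triangle_ineq4)
    moreover have "cmod (y (Suc j) z) \<le> cmod (y j z) + cmod (\<rho> j z)"
      unfolding y_Suc[OF z] \<rho>_def[symmetric] using qy'[OF z] norm_triangle_ineq[of "q j z * y j z" "\<rho> j z"]
      by (smt (verit))
    ultimately have "cmod (x (Suc j) z) + cmod (y (Suc j) z)
        \<le> (cmod (x j z) + cmod (y j z)) * (1 + 2 * e j)"
      using \<rho>[OF z, of j] by (simp add: algebra_simps)
    also have "\<dots> \<le> (\<Prod>i<j. 1 + 2 * e (0 + i)) * (1 + 2 * e j)"
      using Suc e(1)[of j] by (intro mult_right_mono) auto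
    finally show ?case by simp
  qed (simp add: init z)
  have \<rho>2: "cmod (\<rho> j z) \<le> 2 * e j" if z: "z \<in> U" for j z
  proof -
    have "cmod (x j z) + cmod (y j z) \<le> 2"
      using growth[OF z, of j] prod_one_plus_le[of e 0 j, OF e] by linarith
    then show ?thesis using \<rho>[OF z, of j] mult_left_mono[of _ 2 "e j"] e(1)[of j] by fastforce
  qed
  have sum2: "summable (\<lambda>j. 2 * e j)" using e(2) by (rule summable_mult)
  define \<phi> where "\<phi> z = 1 + (\<Sum>j. - \<rho> j z)" for z
  have "uniform_limit U (\<lambda>n z. \<Sum>j<n. - \<rho> j z) (\<lambda>z. \<Sum>j. - \<rho> j z) sequentially"
    using \<rho>2 by (intro Weierstrass_m_test[OF _ sum2]) auto
  then have "uniform_limit U (\<lambda>n z. 1 + (\<Sum>j<n. - \<rho> j z)) \<phi> sequentially"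
    unfolding \<phi>_def by (intro uniform_limit_intros)
  moreover have "1 + (\<Sum>j<n. - \<rho> j z) = x n z" if "z \<in> U" for n z
    by (induction n) (simp_all add: init x_Suc \<rho>_def that)
  ultimately have x_lim: "uniform_limit U x \<phi> sequentially"
    by (subst uniform_limit_cong'[where g = "\<lambda>n z. 1 + (\<Sum>j<n. - \<rho> j z)" and i = \<phi>]) auto
  have \<phi>_near_1: "cmod (\<phi> z - 1) \<le> 1/4" if z: "z \<in> U" for z
  proof -
    have "cmod (\<Sum>j. - \<rho> j z) \<le> (\<Sum>j. 2 * e j)"
      using \<rho>2[OF z] by (intro norm_suminf_le sum2) auto
    also have "\<dots> \<le> 1/4" using e by (simp add: suminf_mult)
    finally show ?thesis by (simp add: \<phi>_def)
  qed
  (* t is a majorant of y that does not depend on z *)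
  define t where "t = rec_nat 0 (\<lambda>n s. (1 - \<delta> n) * s + 2 * e n)"
  have t_Suc: "t (Suc n) = (1 - \<delta> n) * t n + 2 * e n" for n by (simp add: t_def)
  have t_lim: "t \<longlonglongrightarrow> 0"
    using contracting_sequence_tendsto_0[of t \<delta> "\<lambda>n. 2 * e n", OF t_Suc _ \<delta> _ sum2] e(1)
    by (simp add: t_def)
  have y_le: "cmod (y n z) \<le> t n" if z: "z \<in> U" for n z
  proof (induction n)
    case (Suc n)
    have "cmod (y (Suc n) z) \<le> (1 - \<delta> n) * cmod (y n z) + 2 * e n"
      unfolding y_Suc[OF z] \<rho>_def[symmetric] by (intro norm_triangle_mono qy \<rho>2 z)
    also have "\<dots> \<le> t (Suc n)" unfolding t_Suc using Suc \<delta>(2)[of n] by (auto intro: mult_left_mono)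
    finally show ?case .
  qed (simp add: init z t_def)
  have "uniform_limit U y (\<lambda>_. 0) sequentially"
    by (rule uniform_limit_null_comparison[OF _ uniform_limit_of_tendsto[OF t_lim, of U]])
       (use y_le in auto)
  with x_lim \<phi>_near_1 show ?thesis by blast
qed

text \<open>
  The recessive direction is unstable under forward iteration but stable under backward iteration:
  solving the recurrence, divided by the product of the recessive eigenvalues, for the earlier
  vector gives the factor \<open>diag(q j, 1)\<close> with \<open>\<bar>q j\<bar> \<le> 1\<close>. The pair \<open>backward_orbit q A B m j\<close>
  is the value at time \<open>j\<close> of the solution that equals \<open>(0, 1)\<close> at time \<open>j + m\<close>.
\<close>

primrec backward_orbit ::
  "(nat \<Rightarrow> complex) \<Rightarrow> (nat \<Rightarrow> complex) \<Rightarrow> (nat \<Rightarrow> complex) \<Rightarrow> nat \<Rightarrow> nat \<Rightarrow> complex \<times> complex" where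
  "backward_orbit q A B 0 j = (0, 1)"
| "backward_orbit q A B (Suc m) j =
     (let (x, y) = backward_orbit q A B m (Suc j); \<sigma> = A j * x + B j * y in (q j * (x + \<sigma>), y - \<sigma>))"

text \<open>
  By linearity, the increment from \<open>m\<close> to \<open>Suc m\<close> is the image under the backward steps
  \<open>j, \<dots>, j + m - 1\<close> of the error made at time \<open>j + m\<close>, where a single backward step moves
  \<open>(0, 1)\<close> by at most \<open>2 * e (j + m)\<close>.
\<close>

lemma backward_orbit_increment:
  assumes e: "\<And>j. e j \<ge> 0"
    and q: "\<And>j. cmod (q j) \<le> 1" and A: "\<And>j. cmod (A j) \<le> e j" and B: "\<And>j. cmod (B j) \<le> e j"
  shows "cmod (fst (backward_orbit q A B (Suc m) j) - fst (backward_orbit q A B m j)) +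
         cmod (snd (backward_orbit q A B (Suc m) j) - snd (backward_orbit q A B m j))
         \<le> (\<Prod>i<m. 1 + 2 * e (j + i)) * (2 * e (j + m))"
proof (induction m arbitrary: j)
  case 0
  have "cmod (q j * B j) \<le> 1 * e j" unfolding norm_mult
    using q B by (intro mult_mono) auto
  with B[of j] show ?case by (simp add: Let_def)
next
  case (Suc m)
  define X where "X = fst (backward_orbit q A B (Suc m) (Suc j)) - fst (backward_orbit q A B m (Suc j))"
  define Y where "Y = snd (backward_orbit q A B (Suc m) (Suc j)) - snd (backward_orbit q A B m (Suc j))"
  define \<sigma> where "\<sigma> = A j * X + B j * Y"
  have rec: "fst (backward_orbit q A B (Suc (Suc m)) j) - fst (backward_orbit q A B (Suc m) j) = q j * (X + \<sigma>)"
    "snd (backward_orbit q A B (Suc (Suc m)) j) - snd (backward_orbit q A B (Suc m) j) = Y - \<sigma>"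
    unfolding backward_orbit.simps(2)[of q A B "Suc m" j] backward_orbit.simps(2)[of q A B m j]
      Let_def case_prod_beta X_def Y_def \<sigma>_def by (simp_all add: algebra_simps del: backward_orbit.simps)
  have \<sigma>: "cmod \<sigma> \<le> e j * cmod X + e j * cmod Y"
    unfolding \<sigma>_def using A[of j] B[of j]
    by (intro norm_triangle_mono) (auto simp: norm_mult intro!: mult_right_mono)
  have "cmod (q j * (X + \<sigma>)) + cmod (Y - \<sigma>) \<le> (cmod X + cmod \<sigma>) + (cmod Y + cmod \<sigma>)"
  proof (rule add_mono)
    have "cmod (q j * (X + \<sigma>)) \<le> 1 * cmod (X + \<sigma>)"
      unfolding norm_mult using q by (intro mult_right_mono) auto
    then show "cmod (q j * (X + \<sigma>)) \<le> cmod X + cmod \<sigma>" using norm_triangle_ineq[of X \<sigma>] by simp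
  qed (rule norm_triangle_ineq4)
  also have "\<dots> \<le> (1 + 2 * e j) * (cmod X + cmod Y)" using \<sigma> by (simp add: algebra_simps)
  also have "\<dots> \<le> (1 + 2 * e j) * ((\<Prod>i<m. 1 + 2 * e (Suc j + i)) * (2 * e (Suc j + m)))"
    using Suc[of "Suc j"] e[of j] unfolding X_def Y_def by (intro mult_left_mono) auto
  also have "\<dots> = (\<Prod>i<Suc m. 1 + 2 * e (j + i)) * (2 * e (j + Suc m))"
    by (simp add: prod.lessThan_Suc_shift del: prod.lessThan_Suc)
  finally show ?case unfolding rec .
qed

lemma holomorphic_on_uniform_limit:
  assumes U: "open U" and hol: "\<And>n. f n holomorphic_on U" and lim: "uniform_limit U f g sequentially"
  shows "g holomorphic_on U"
proof (rule holomorphic_uniform_sequence[OF U hol])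
  fix z assume "z \<in> U"
  then obtain d where "d > 0" "cball z d \<subseteq> U" using U open_contains_cball by blast
  with lim show "\<exists>d. 0 < d \<and> cball z d \<subseteq> U \<and> uniform_limit (cball z d) f g sequentially"
    by (blast intro: uniform_limit_on_subset)
qed

text \<open>
  The backward orbits started at ever later times form a uniformly convergent sequence, because
  their increments are summable; the limit solves the recurrence for all times and tends to
  \<open>(0, 1)\<close>. It is holomorphic as a locally uniform limit of functions built from finitely many
  coefficients.
\<close>

lemma recessive_solution:
  fixes q A B :: "nat \<Rightarrow> complex \<Rightarrow> complex" and e :: "nat \<Rightarrow> real"
  assumes U: "open U"
    and e: "\<And>j. e j \<ge> 0" "summable e" "suminf e \<le> 1/8"
    and q: "\<And>j z. z \<in> U \<Longrightarrow> cmod (q j z) \<le> 1"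
    and A: "\<And>j z. z \<in> U \<Longrightarrow> cmod (A j z) \<le> e j"
    and B: "\<And>j z. z \<in> U \<Longrightarrow> cmod (B j z) \<le> e j"
    and hol: "\<And>j. q j holomorphic_on U" "\<And>j. A j holomorphic_on U" "\<And>j. B j holomorphic_on U"
  shows "\<exists>X Y.
    (\<forall>j. \<forall>z\<in>U. X j z = q j z * (X (Suc j) z + (A j z * X (Suc j) z + B j z * Y (Suc j) z))) \<and>
    (\<forall>j. \<forall>z\<in>U. Y j z = Y (Suc j) z - (A j z * X (Suc j) z + B j z * Y (Suc j) z)) \<and>
    uniform_limit U X (\<lambda>_. 0) sequentially \<and> uniform_limit U Y (\<lambda>_. 1) sequentially \<and>
    (\<forall>z\<in>U. Y 0 z \<noteq> 0) \<and> (\<forall>j. X j holomorphic_on U \<and> Y j holomorphic_on U)"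
proof -
  define x where "x m j z = fst (backward_orbit (\<lambda>j. q j z) (\<lambda>j. A j z) (\<lambda>j. B j z) m j)" for m j z
  define y where "y m j z = snd (backward_orbit (\<lambda>j. q j z) (\<lambda>j. A j z) (\<lambda>j. B j z) m j)" for m j z
  have x0: "x 0 j z = 0" and y0: "y 0 j z = 1" for j z by (simp_all add: x_def y_def)
  have x_Suc: "x (Suc m) j z = q j z * (x m (Suc j) z + (A j z * x m (Suc j) z + B j z * y m (Suc j) z))"
    and y_Suc: "y (Suc m) j z = y m (Suc j) z - (A j z * x m (Suc j) z + B j z * y m (Suc j) z)" for m j z
    by (simp_all add: x_def y_def Let_def case_prod_beta)
  have hol_xy: "x m j holomorphic_on U \<and> y m j holomorphic_on U" for m j
  proof (induction m arbitrary: j)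
    case 0
    have "x 0 j = (\<lambda>_. 0)" "y 0 j = (\<lambda>_. 1)" by (simp_all add: x0 y0 fun_eq_iff)
    then show ?case by simp
  next
    case (Suc m)
    have "x (Suc m) j = (\<lambda>z. q j z * (x m (Suc j) z + (A j z * x m (Suc j) z + B j z * y m (Suc j) z)))"
      "y (Suc m) j = (\<lambda>z. y m (Suc j) z - (A j z * x m (Suc j) z + B j z * y m (Suc j) z))"
      by (simp_all add: x_Suc y_Suc fun_eq_iff)
    then show ?case using Suc[of "Suc j"] hol by (auto intro!: holomorphic_intros)
  qed
  have inc: "cmod (x (Suc m) j z - x m j z) + cmod (y (Suc m) j z - y m j z) \<le> 4 * e (m + j)"
    if z: "z \<in> U" for m j z
  proof -
    have "cmod (x (Suc m) j z - x m j z) + cmod (y (Suc m) j z - y m j z)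
        \<le> (\<Prod>i<m. 1 + 2 * e (j + i)) * (2 * e (j + m))"
      unfolding x_def y_def by (intro backward_orbit_increment e q A B z)
    also have "\<dots> \<le> 2 * (2 * e (j + m))"
      using e(1)[of "j + m"] by (intro mult_right_mono prod_one_plus_le e) auto
    finally show ?thesis by (simp add: add.commute)
  qed
  have sum4: "summable (\<lambda>m. 4 * e (m + j))" for j
    using e(2) by (intro summable_mult summable_ignore_initial_segment)
  have inc_x: "cmod (x (Suc m) j z - x m j z) \<le> 4 * e (m + j)"
    and inc_y: "cmod (y (Suc m) j z - y m j z) \<le> 4 * e (m + j)" if "z \<in> U" for m j z
    using inc[OF that, of m j] norm_ge_zero[of "y (Suc m) j z - y m j z"]
      norm_ge_zero[of "x (Suc m) j z - x m j z"] by linarith+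
  define X where "X j z = (\<Sum>m. x (Suc m) j z - x m j z)" for j z
  define Y where "Y j z = 1 + (\<Sum>m. y (Suc m) j z - y m j z)" for j z
  have X_lim: "uniform_limit U (\<lambda>m. x m j) (X j) sequentially" for j
  proof -
    have "uniform_limit U (\<lambda>n z. \<Sum>m<n. x (Suc m) j z - x m j z) (X j) sequentially"
      unfolding X_def using inc_x by (intro Weierstrass_m_test[OF _ sum4]) auto
    moreover have "(\<lambda>n z. \<Sum>m<n. x (Suc m) j z - x m j z) = (\<lambda>m. x m j)"
      by (simp add: fun_eq_iff sum_lessThan_telescope[of "\<lambda>m. x m j _"] x0)
    ultimately show ?thesis by simp
  qed
  have Y_lim: "uniform_limit U (\<lambda>m. y m j) (Y j) sequentially" for j
  proof -
    have "uniform_limit U (\<lambda>n z. 1 + (\<Sum>m<n. y (Suc m) j z - y m j z)) (Y j) sequentially"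
      unfolding Y_def using inc_y by (intro uniform_limit_intros Weierstrass_m_test[OF _ sum4]) auto
    moreover have "(\<lambda>n z. 1 + (\<Sum>m<n. y (Suc m) j z - y m j z)) = (\<lambda>m. y m j)"
      by (simp add: fun_eq_iff sum_lessThan_telescope[of "\<lambda>m. y m j _"] y0)
    ultimately show ?thesis by simp
  qed
  have X_pt: "(\<lambda>m. x m j z) \<longlonglongrightarrow> X j z" and Y_pt: "(\<lambda>m. y m j z) \<longlonglongrightarrow> Y j z" if "z \<in> U" for j z
    using that tendsto_uniform_limitI[OF X_lim] tendsto_uniform_limitI[OF Y_lim] by blast+
  have X_eq: "X j z = q j z * (X (Suc j) z + (A j z * X (Suc j) z + B j z * Y (Suc j) z))"
    and Y_eq: "Y j z = Y (Suc j) z - (A j z * X (Suc j) z + B j z * Y (Suc j) z)" if z: "z \<in> U" for j z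
  proof -
    have "(\<lambda>m. x (Suc m) j z) \<longlonglongrightarrow> q j z * (X (Suc j) z + (A j z * X (Suc j) z + B j z * Y (Suc j) z))"
      unfolding x_Suc by (intro tendsto_intros X_pt Y_pt z)
    then show "X j z = q j z * (X (Suc j) z + (A j z * X (Suc j) z + B j z * Y (Suc j) z))"
      using LIMSEQ_unique[OF LIMSEQ_Suc[OF X_pt[OF z]]] by blast
    have "(\<lambda>m. y (Suc m) j z) \<longlonglongrightarrow> Y (Suc j) z - (A j z * X (Suc j) z + B j z * Y (Suc j) z)"
      unfolding y_Suc by (intro tendsto_intros X_pt Y_pt z)
    then show "Y j z = Y (Suc j) z - (A j z * X (Suc j) z + B j z * Y (Suc j) z)"
      using LIMSEQ_unique[OF LIMSEQ_Suc[OF Y_pt[OF z]]] by blast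
  qed
  have X_le: "cmod (X j z) \<le> (\<Sum>m. 4 * e (m + j))"
    and Y_le: "cmod (Y j z - 1) \<le> (\<Sum>m. 4 * e (m + j))" if "z \<in> U" for j z
    unfolding X_def Y_def using inc_x[OF that, of _ j] inc_y[OF that, of _ j] sum4
    by (auto intro!: norm_suminf_le)
  have tail: "(\<lambda>j. \<Sum>m. 4 * e (m + j)) \<longlonglongrightarrow> 0"
  proof (rule LIMSEQ_I)
    fix r :: real assume "r > 0"
    from suminf_exist_split[OF this summable_mult[OF e(2), of 4]]
    show "\<exists>no. \<forall>n\<ge>no. norm ((\<Sum>m. 4 * e (m + n)) - 0) < r" by simp
  qed
  have limX: "uniform_limit U X (\<lambda>_. 0) sequentially"
    by (rule uniform_limit_null_comparison[OF _ uniform_limit_of_tendsto[OF tail, of U]])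
       (use X_le in auto)
  have "uniform_limit U (\<lambda>j z. Y j z - 1) (\<lambda>_. 0) sequentially"
    by (rule uniform_limit_null_comparison[OF _ uniform_limit_of_tendsto[OF tail, of U]])
       (use Y_le in auto)
  from uniform_limit_add[OF this uniform_limit_const[where S = U and c = "\<lambda>_. 1"]]
  have limY: "uniform_limit U Y (\<lambda>_. 1) sequentially" by simp
  have Y_nz: "Y 0 z \<noteq> 0" if z: "z \<in> U" for z
  proof
    assume "Y 0 z = 0"
    then have "1 \<le> (\<Sum>m. 4 * e m)" using Y_le[OF z, of 0] by simp
    also have "\<dots> = 4 * suminf e" using e(2) by (simp add: suminf_mult)
    finally show False using e(3) by simp
  qed
  have "X j holomorphic_on U" "Y j holomorphic_on U" for j
    using hol_xy by (auto intro: holomorphic_on_uniform_limit[OF U _ X_lim]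
        holomorphic_on_uniform_limit[OF U _ Y_lim])
  show ?thesis
    using X_eq Y_eq limX limY Y_nz \<open>\<And>j. X j holomorphic_on U\<close> \<open>\<And>j. Y j holomorphic_on U\<close> by (intro exI[of _ X] exI[of _ Y]) blast
qed

section \<open>Limits of transfer matrices along a residue class\<close>

text \<open>
  At the very first index the transfer matrix has the exceptional entry \<open>1 / a 0\<close>, and the sequences
  \<open>b n / a n\<close> and \<open>1 / a n\<close> are only assumed to have bounded variation from \<open>n = 1\<close> on. Dropping the
  first block removes both irregularities.
\<close>

lemma uniformly_bv_Suc_imp:
  assumes "uniformly_bv U (\<lambda>j. f (Suc j)) l"
  shows "uniformly_bv U f l"
proof -
  obtain g where g: "uniform_limit U (\<lambda>j. f (Suc j)) (\<lambda>_. l) sequentially" "summable g"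
    "\<forall>\<^sub>F j in sequentially. \<forall>z\<in>U. cmod (f (Suc (Suc j)) z - f (Suc j) z) \<le> g j"
    using uniformly_bvE[OF assms] .
  show ?thesis
  proof (rule uniformly_bvI)
    show "uniform_limit U f (\<lambda>_. l) sequentially"
      using g(1) by (simp add: filterlim_sequentially_Suc)
    show "summable (\<lambda>j. g (j - 1))" using g(2) by (subst summable_Suc_iff[symmetric]) simp
    have "\<forall>\<^sub>F j in sequentially. \<forall>z\<in>U. cmod (f (Suc (Suc j)) z - f (Suc j) z) \<le> g (Suc j - 1)"
      using g(3) by simp
    then show "\<forall>\<^sub>F j in sequentially. \<forall>z\<in>U. cmod (f (Suc j) z - f j z) \<le> g (j - 1)"
      by (rule eventually_sequentially_Suc[THEN iffD1])
  qed
qed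

lemma uniformly_bv_scaled_identity:
  fixes x :: "nat \<Rightarrow> real"
  assumes "bounded U" "x \<longlonglongrightarrow> 0" "summable (\<lambda>j. \<bar>x (Suc j) - x j\<bar>)"
  shows "uniformly_bv U (\<lambda>j z. z * complex_of_real (x j)) 0"
proof -
  obtain R where R: "\<And>z. z \<in> U \<Longrightarrow> cmod z \<le> R" "R > 0"
    using assms(1) by (meson bounded_pos)
  show ?thesis
  proof (rule uniformly_bvI)
    have "(\<lambda>j. R * \<bar>x j\<bar>) \<longlonglongrightarrow> R * \<bar>0\<bar>" by (intro tendsto_intros assms(2))
    then have "uniform_limit U (\<lambda>j _. R * \<bar>x j\<bar>) (\<lambda>_. 0) sequentially"
      by (intro uniform_limit_of_tendsto) simp
    then show "uniform_limit U (\<lambda>j z. z * complex_of_real (x j)) (\<lambda>_. 0) sequentially"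
      by (rule uniform_limit_null_comparison[rotated])
         (auto simp: norm_mult intro!: always_eventually mult_right_mono R)
    show "summable (\<lambda>j. R * \<bar>x (Suc j) - x j\<bar>)" by (intro summable_mult assms(3))
    show "\<forall>\<^sub>F j in sequentially. \<forall>z\<in>U.
        cmod (z * complex_of_real (x (Suc j)) - z * complex_of_real (x j)) \<le> R * \<bar>x (Suc j) - x j\<bar>"
      using R(1) by (intro always_eventually)
        (auto simp: norm_mult simp flip: right_diff_distrib of_real_diff intro!: mult_right_mono)
  qed
qed

lemma periodic_seq_shift: "periodic_seq N p \<Longrightarrow> p (k + int (j * N)) = p k"
proof (induction j)
  case (Suc j)
  have "p (k + int (Suc j * N)) = p ((k + int (j * N)) + int N)" by (simp add: algebra_simps)
  also have "\<dots> = p k" using Suc unfolding periodic_seq_def by metis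
  finally show ?case .
qed simp

lemma residue_class_summable:
  assumes "bounded_variation_step N h" "N \<ge> 1"
  shows "summable (\<lambda>j. \<bar>h (Suc j * N + m) - h (j * N + m)\<bar>)"
proof -
  have "inj (\<lambda>j. j * N + m)" using assms(2) by (auto intro!: injI)
  from summable_reindex[OF assms(1)[unfolded bounded_variation_step_def] this]
  show ?thesis by (simp add: o_def add_ac)
qed

lemma residue_class_tendsto:
  fixes h :: "nat \<Rightarrow> real"
  assumes lim: "(\<lambda>n. h n - p (int n)) \<longlonglongrightarrow> 0" and p: "periodic_seq N p" and N: "N \<ge> 1"
  shows "(\<lambda>j. h (j * N + m)) \<longlonglongrightarrow> p (int m)"
proof -
  have "filterlim (\<lambda>j. j * N + m) at_top sequentially"
    using N by (intro filterlim_subseq) (auto intro!: strict_monoI)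
  from filterlim_compose[OF lim this]
  have "(\<lambda>j. h (j * N + m) - p (int (j * N + m))) \<longlonglongrightarrow> 0" by simp
  moreover have "p (int (j * N + m)) = p (int m)" for j
    using periodic_seq_shift[OF p, of "int m" j] by (simp add: add.commute)
  ultimately show ?thesis by (simp add: LIM_zero_iff)
qed

text \<open>
  Multiplication by a transfer matrix moves the second row up and forms a new second row by the
  three-term recurrence. All facts about entries of products below follow this pattern.
\<close>

lemma step_product_transfer_Suc:
  "step_product (transfer a b) n (Suc k) z $ 1 $ c = step_product (transfer a b) n k z $ 2 $ c"
  "step_product (transfer a b) n (Suc k) z $ 2 $ c =
     - (of_real (if n + k = 0 then 1 else a (n + k - 1)) / of_real (a (n + k))) * step_product (transfer a b) n k z $ 1 $ c
     + (z - of_real (b (n + k))) / of_real (a (n + k)) * step_product (transfer a b) n k z $ 2 $ c"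
  by (simp_all add: matrix_matrix_mult_def transfer_def sum_2)

lemma step_product_periodic_Suc:
  "step_product (periodic_transfer \<alpha> \<beta>) n (Suc k) x $ 1 $ c = step_product (periodic_transfer \<alpha> \<beta>) n k x $ 2 $ c"
  "step_product (periodic_transfer \<alpha> \<beta>) n (Suc k) x $ 2 $ c =
     - (\<alpha> (n + int k - 1) / \<alpha> (n + int k)) * step_product (periodic_transfer \<alpha> \<beta>) n k x $ 1 $ c
     + (x - \<beta> (n + int k)) / \<alpha> (n + int k) * step_product (periodic_transfer \<alpha> \<beta>) n k x $ 2 $ c"
  by (simp_all add: matrix_matrix_mult_def periodic_transfer_def sum_2)

lemma det_step_product_transfer:
  assumes "\<And>n. a n > 0"
  shows "\<exists>d>0. det (step_product (transfer a b) n k z) = complex_of_real d"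
proof (induction k)
  case 0
  show ?case by (intro exI[of _ 1]) simp
next
  case (Suc k)
  then obtain d where d: "d > 0" "det (step_product (transfer a b) n k z) = complex_of_real d" by blast
  have "det (transfer a b (n + k) z) = complex_of_real ((if n + k = 0 then 1 else a (n + k - 1)) / a (n + k))"
    by (simp add: det_2 transfer_def)
  then have "det (step_product (transfer a b) n (Suc k) z)
      = complex_of_real ((if n + k = 0 then 1 else a (n + k - 1)) / a (n + k) * d)"
    using d by (simp add: det_mul)
  moreover have "(if n + k = 0 then 1 else a (n + k - 1)) / a (n + k) * d > 0"
    using d assms by simp
  ultimately show ?case by blast
qed

lemma det_step_product_periodic:
  assumes "\<And>n. \<alpha> n > 0"
  shows "det (step_product (periodic_transfer \<alpha> \<beta>) n k x) = \<alpha> (n - 1) / \<alpha> (n + int k - 1)"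
proof (induction k)
  case 0
  show ?case using assms[of "n - 1"] by simp
next
  case (Suc k)
  have "det (periodic_transfer \<alpha> \<beta> (n + int k) x) = \<alpha> (n + int k - 1) / \<alpha> (n + int k)"
    by (simp add: det_2 periodic_transfer_def)
  then show ?case
    using Suc assms[of "n + int k - 1"] assms[of "n + int k"] by (simp add: det_mul add_ac)
qed

lemma has_real_derivative_entry_imp_vector_derivative:
  fixes F :: "real \<Rightarrow> real^2^2"
  assumes "\<And>r c. ((\<lambda>x. F x $ r $ c) has_real_derivative D r c) (at t)"
  shows "vector_derivative F (at t) = (\<chi> r c. D r c)"
proof (rule vector_derivative_at)
  show "(F has_vector_derivative (\<chi> r c. D r c)) (at t)"
    unfolding has_vector_derivative_def
  proof (subst has_derivative_componentwise_within, intro ballI)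
    fix i :: "real^2^2" assume "i \<in> Basis"
    then obtain r c where i: "i = axis r (axis c 1)"
      by (auto simp: Basis_vec_def)
    have *: "G \<bullet> i = G $ r $ c" for G :: "real^2^2" by (simp add: i inner_axis)
    show "((\<lambda>x. F x \<bullet> i) has_derivative (\<lambda>x. (x *\<^sub>R (\<chi> r c. D r c)) \<bullet> i)) (at t)"
      using assms[of r c] unfolding * has_field_derivative_def
      by (simp add: mult.commute[of _ "D r c"])
  qed
qed

lemma summable_residue_classes:
  fixes f :: "nat \<Rightarrow> real"
  assumes nonneg: "\<And>n. f n \<ge> 0" and N: "N \<ge> 1" and sum: "\<And>i. i < N \<Longrightarrow> summable (\<lambda>j. f (j * N + i))"
  shows "summable f"
proof -
  define g where "g j = (\<Sum>i<N. f (j * N + i))" for j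
  have g: "summable g" unfolding g_def using sum by (intro summable_sum) auto
  have g_nonneg: "g j \<ge> 0" for j unfolding g_def by (intro sum_nonneg nonneg)
  have block: "sum f {j * N..<j * N + N} = g j" for j
    using sum.shift_bounds_nat_ivl[of f 0 "j * N" N]
    by (simp add: g_def lessThan_atLeast0 add.commute)
  show ?thesis
  proof (rule summableI_nonneg_bounded[OF nonneg])
    fix n
    have "(\<Sum>i<n. f i) \<le> (\<Sum>i<n * N. f i)"
      using N nonneg by (intro sum_mono2) auto
    also have "\<dots> = (\<Sum>j<n. g j)" by (simp add: sum.nat_group[symmetric] block)
    also have "\<dots> \<le> suminf g" by (intro sum_le_suminf g g_nonneg) auto
    finally show "(\<Sum>i<n. f i) \<le> suminf g" .
  qed
qed

text \<open>
  The spectral parameter ranges over a bounded set \<open>U\<close>, on which all convergence is uniform.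
\<close>

locale modulated_jacobi =
  fixes N :: nat and a b :: "nat \<Rightarrow> real" and \<alpha> \<beta> :: "int \<Rightarrow> real" and U :: "complex set"
  assumes N: "N \<ge> 1"
    and a_pos: "\<And>n. a n > 0"
    and modulated: "periodically_modulated N \<alpha> \<beta> a b"
    and bv_ratio: "bounded_variation_step N (\<lambda>n. a n / a (Suc n))"
    and bv_diag: "bounded_variation_step N (\<lambda>n. b (Suc n) / a (Suc n))"
    and bv_inv: "bounded_variation_step N (\<lambda>n. 1 / a (Suc n))"
    and bounded_U: "bounded U"
begin

text \<open>
  Both products start at the same phase of the period, so that \<open>S j k z\<close> tends to \<open>P k 0\<close> as
  \<open>j\<close> tends to infinity.
\<close>

abbreviation S where "S j k z \<equiv> step_product (transfer a b) (j * N) k z"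
abbreviation P where "P k x \<equiv> step_product (periodic_transfer \<alpha> \<beta>) 0 k x"

lemma \<alpha>_pos: "\<alpha> n > 0" and \<alpha>_per: "periodic_seq N \<alpha>" and \<beta>_per: "periodic_seq N \<beta>"
  and a_ratio: "(\<lambda>n. a n / a (Suc n) - \<alpha> (int n) / \<alpha> (int n + 1)) \<longlonglongrightarrow> 0"
  and b_ratio: "(\<lambda>n. b n / a n - \<beta> (int n) / \<alpha> (int n)) \<longlonglongrightarrow> 0"
  and a_infinity: "filterlim a at_top sequentially"
  using modulated unfolding periodically_modulated_def by auto

lemma \<alpha>_nonzero: "\<alpha> n \<noteq> 0" using \<alpha>_pos[of n] by simp

lemma previous_index: "int (N + i - 1) = (int i - 1) + int (1 * N)" "Suc (j * N + (N + i - 1)) = Suc j * N + i"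
  "j * N + (N + i - 1) = Suc j * N + i - 1"
  using N by (auto simp: of_nat_diff)

lemma ratio_uniformly_bv:
  "uniformly_bv U (\<lambda>j _. of_real (if j * N + i = 0 then 1 else a (j * N + i - 1)) / of_real (a (j * N + i)))
     (of_real (\<alpha> (int i - 1) / \<alpha> (int i)))"
proof (rule uniformly_bv_Suc_imp)
  let ?m = "N + i - 1"
  have per: "periodic_seq N (\<lambda>n. \<alpha> n / \<alpha> (n + 1))"
    using \<alpha>_per unfolding periodic_seq_def by (metis add.assoc add.commute)
  have "(\<lambda>j. a (j * N + ?m) / a (Suc (j * N + ?m))) \<longlonglongrightarrow> \<alpha> (int ?m) / \<alpha> (int ?m + 1)"
    by (rule residue_class_tendsto[OF a_ratio per N])
  also have "\<alpha> (int ?m) / \<alpha> (int ?m + 1) = \<alpha> (int i - 1) / \<alpha> (int i)"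
    using periodic_seq_shift[OF per, of "int i - 1" 1] unfolding previous_index(1) by simp
  finally have "uniformly_bv U (\<lambda>j _. of_real (a (j * N + ?m) / a (Suc (j * N + ?m)))) (of_real (\<alpha> (int i - 1) / \<alpha> (int i)))"
    using residue_class_summable[OF bv_ratio N, of ?m] by (rule uniformly_bv_of_real)
  moreover have eq: "a (j * N + ?m) / a (Suc (j * N + ?m)) = a (Suc j * N + i - 1) / a (Suc j * N + i)" for j
    unfolding previous_index(2) unfolding previous_index(3) by (rule refl)
  moreover have "Suc j * N + i \<noteq> 0" for j using N by simp
  ultimately show "uniformly_bv U (\<lambda>j _. of_real (if Suc j * N + i = 0 then 1 else a (Suc j * N + i - 1)) / of_real (a (Suc j * N + i)))
     (of_real (\<alpha> (int i - 1) / \<alpha> (int i)))"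
    unfolding eq by (simp only: if_False of_real_divide)
qed

lemma diagonal_uniformly_bv:
  "uniformly_bv U (\<lambda>j _. of_real (b (j * N + i) / a (j * N + i))) (of_real (\<beta> (int i) / \<alpha> (int i)))"
proof (rule uniformly_bv_Suc_imp)
  let ?m = "N + i - 1"
  have per: "periodic_seq N (\<lambda>n. \<beta> n / \<alpha> n)"
    using \<alpha>_per \<beta>_per unfolding periodic_seq_def by metis
  have "(\<lambda>j. b (j * N + i) / a (j * N + i)) \<longlonglongrightarrow> \<beta> (int i) / \<alpha> (int i)"
    by (rule residue_class_tendsto[OF b_ratio per N])
  then have "(\<lambda>j. b (Suc j * N + i) / a (Suc j * N + i)) \<longlonglongrightarrow> \<beta> (int i) / \<alpha> (int i)"
    by (rule LIMSEQ_Suc)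
  then show "uniformly_bv U (\<lambda>j _. of_real (b (Suc j * N + i) / a (Suc j * N + i))) (of_real (\<beta> (int i) / \<alpha> (int i)))"
    using residue_class_summable[OF bv_diag N, of ?m, unfolded previous_index(2)] by (rule uniformly_bv_of_real)
qed

lemma inverse_a_tendsto_0: "(\<lambda>j. 1 / a (j * N + i)) \<longlonglongrightarrow> 0"
proof -
  have "filterlim (\<lambda>j. j * N + i) at_top sequentially"
    using N by (intro filterlim_subseq) (auto intro!: strict_monoI)
  from filterlim_compose[OF a_infinity this] show ?thesis
    by (intro tendsto_divide_0[OF tendsto_const] filterlim_at_top_imp_at_infinity) (simp add: o_def)
qed

lemma spectral_uniformly_bv: "uniformly_bv U (\<lambda>j z. z * of_real (1 / a (j * N + i))) 0"
proof (rule uniformly_bv_Suc_imp)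
  let ?m = "N + i - 1"
  show "uniformly_bv U (\<lambda>j z. z * of_real (1 / a (Suc j * N + i))) 0"
    using bounded_U LIMSEQ_Suc[OF inverse_a_tendsto_0[of i]] residue_class_summable[OF bv_inv N, of ?m, unfolded previous_index(2)]
    by (rule uniformly_bv_scaled_identity)
qed

lemma coefficient_uniformly_bv:
  "uniformly_bv U (\<lambda>j z. (z - of_real (b (j * N + i))) / of_real (a (j * N + i))) (of_real ((0 - \<beta> (int i)) / \<alpha> (int i)))"
  using uniformly_bv_diff[OF spectral_uniformly_bv[of i] diagonal_uniformly_bv[of i]]
  by (simp add: diff_divide_distrib)

lemma entries_uniformly_bv: "\<forall>r c. uniformly_bv U (\<lambda>j z. S j k z $ r $ c) (of_real (P k 0 $ r $ c))"
proof (induction k)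
  case 0
  have "complex_of_real ((mat 1 :: real^2^2) $ r $ c) = (mat 1 :: complex^2^2) $ r $ c" for r c :: 2
    by (simp add: mat_def)
  then show ?case by (simp add: uniformly_bv_const)
next
  case (Suc k)
  show ?case unfolding forall_2
  proof (intro conjI)
    fix c :: 2
    have 1: "uniformly_bv U (\<lambda>j z. S j (Suc k) z $ 1 $ c) (of_real (P (Suc k) 0 $ 1 $ c))" for c
      unfolding step_product_transfer_Suc(1) step_product_periodic_Suc(1) using Suc by blast
    have 2: "uniformly_bv U (\<lambda>j z. S j (Suc k) z $ 2 $ c) (of_real (P (Suc k) 0 $ 2 $ c))" for c
      unfolding step_product_transfer_Suc(2) step_product_periodic_Suc(2) of_real_add of_real_mult of_real_minus add_0_left
      using Suc by (intro uniformly_bv_add uniformly_bv_mult uniformly_bv_uminus ratio_uniformly_bv coefficient_uniformly_bv) auto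
    show "uniformly_bv U (\<lambda>j z. S j (Suc k) z $ 1 $ 1) (of_real (P (Suc k) 0 $ 1 $ 1))"
      "uniformly_bv U (\<lambda>j z. S j (Suc k) z $ 1 $ 2) (of_real (P (Suc k) 0 $ 1 $ 2))"
      "uniformly_bv U (\<lambda>j z. S j (Suc k) z $ 2 $ 1) (of_real (P (Suc k) 0 $ 2 $ 1))"
      "uniformly_bv U (\<lambda>j z. S j (Suc k) z $ 2 $ 2) (of_real (P (Suc k) 0 $ 2 $ 2))"
      using 1 2 by blast+
  qed
qed

lemma a_quotient_tendsto: "(\<lambda>j. a (j * N) / a (j * N + i)) \<longlonglongrightarrow> \<alpha> 0 / \<alpha> (int i)"
proof (induction i)
  case 0
  show ?case using a_pos[of "_ * N"] \<alpha>_pos[of 0] by (simp add: less_imp_neq[THEN not_sym])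
next
  case (Suc i)
  have per: "periodic_seq N (\<lambda>n. \<alpha> n / \<alpha> (n + 1))"
    using \<alpha>_per unfolding periodic_seq_def by (metis add.assoc add.commute)
  have "(\<lambda>j. a (j * N) / a (j * N + i) * (a (j * N + i) / a (Suc (j * N + i))))
      \<longlonglongrightarrow> \<alpha> 0 / \<alpha> (int i) * (\<alpha> (int i) / \<alpha> (int i + 1))"
    by (intro tendsto_mult Suc residue_class_tendsto[OF a_ratio per N])
  moreover have "a (j * N) / a (j * N + i) * (a (j * N + i) / a (Suc (j * N + i))) = a (j * N) / a (j * N + Suc i)" for j
    using a_pos[of "j * N + i"] a_pos[of "j * N + Suc i"] by (simp add: field_simps)
  moreover have "\<alpha> 0 / \<alpha> (int i) * (\<alpha> (int i) / \<alpha> (int i + 1)) = \<alpha> 0 / \<alpha> (int (Suc i))"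
    using \<alpha>_nonzero by (simp add: add.commute)
  ultimately show ?case by (simp only:)
qed

text \<open>
  Within a block all \<open>a n\<close> are comparable to the first one, so that Carleman's condition can be
  read off from one entry per block.
\<close>

lemma not_summable_block:
  assumes "\<not> summable (\<lambda>n. 1 / a n)"
  shows "\<not> summable (\<lambda>j. 1 / a (j * N))"
proof
  assume *: "summable (\<lambda>j. 1 / a (j * N))"
  have "summable (\<lambda>n. 1 / a n)"
  proof (rule summable_residue_classes[OF _ N])
    fix i
    obtain C where C: "\<And>j. \<bar>a (j * N) / a (j * N + i)\<bar> \<le> C"
      using convergent_imp_Bseq[OF convergentI[OF a_quotient_tendsto[of i]]] unfolding Bseq_def by auto
    have "summable (\<lambda>j. C * (1 / a (j * N)))" using * by (rule summable_mult)
    then show "summable (\<lambda>j. 1 / a (j * N + i))"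
    proof (rule summable_comparison_test'[of _ 0])
      fix j
      have "1 / a (j * N + i) = a (j * N) / a (j * N + i) * (1 / a (j * N))"
        using a_pos[of "j * N"] by simp
      also have "\<dots> \<le> C * (1 / a (j * N))"
        using abs_le_D1[OF C[of j]] a_pos[of "j * N"] by (intro mult_right_mono) auto
      finally show "norm (1 / a (j * N + i)) \<le> C * (1 / a (j * N))"
        using a_pos[of "j * N + i"] by simp
    qed
  qed (use a_pos in \<open>simp add: less_imp_le\<close>)
  with assms show False by blast
qed

text \<open>
  The imaginary part acts as a derivation here. If \<open>f\<close> and \<open>g\<close> tend to real constants, then
  \<open>Im (f g) = Im f Re g + Re f Im g\<close> shows that the rescaled limits of \<open>Im f\<close> and \<open>Im g\<close> combine
  by Leibniz' rule, exactly as the derivatives of the limiting polynomials at \<open>0\<close> do. The factor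
  \<open>\<alpha> 0\<close> arises because \<open>a (j N) / a (j N + i)\<close> tends to \<open>\<alpha> 0 / \<alpha> i\<close>, whereas the periodic
  matrices carry \<open>1 / \<alpha> i\<close>.
\<close>

lemma Im_entries_limit:
  "\<forall>r c. \<exists>d. ((\<lambda>x. P k x $ r $ c) has_real_derivative d) (at 0) \<and>
     uniform_limit U (\<lambda>j z. Im (S j k z $ r $ c) * a (j * N)) (\<lambda>z. \<alpha> 0 * d * Im z) sequentially"
proof (induction k)
  case 0
  have "Im ((mat 1 :: complex^2^2) $ r $ c) = 0" for r c :: 2 by (simp add: mat_def)
  then show ?case
    by (intro allI exI[of _ 0]) (auto intro!: derivative_eq_intros uniform_limit_const)
next
  case (Suc k)
  have 1: "\<exists>d. ((\<lambda>x. P (Suc k) x $ 1 $ c) has_real_derivative d) (at 0) \<and>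
     uniform_limit U (\<lambda>j z. Im (S j (Suc k) z $ 1 $ c) * a (j * N)) (\<lambda>z. \<alpha> 0 * d * Im z) sequentially" for c
    unfolding step_product_transfer_Suc(1) step_product_periodic_Suc(1) using Suc by blast
  have 2: "\<exists>d. ((\<lambda>x. P (Suc k) x $ 2 $ c) has_real_derivative d) (at 0) \<and>
     uniform_limit U (\<lambda>j z. Im (S j (Suc k) z $ 2 $ c) * a (j * N)) (\<lambda>z. \<alpha> 0 * d * Im z) sequentially" for c
  proof -
    obtain d1 where d1: "((\<lambda>x. P k x $ 1 $ c) has_real_derivative d1) (at 0)"
      "uniform_limit U (\<lambda>j z. Im (S j k z $ 1 $ c) * a (j * N)) (\<lambda>z. \<alpha> 0 * d1 * Im z) sequentially"
      using Suc by blast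
    obtain d2 where d2: "((\<lambda>x. P k x $ 2 $ c) has_real_derivative d2) (at 0)"
      "uniform_limit U (\<lambda>j z. Im (S j k z $ 2 $ c) * a (j * N)) (\<lambda>z. \<alpha> 0 * d2 * Im z) sequentially"
      using Suc by blast
    let ?\<rho> = "\<alpha> (int k - 1) / \<alpha> (int k)" and ?\<gamma> = "- \<beta> (int k) / \<alpha> (int k)"
    define d where "d = - ?\<rho> * d1 + (1 / \<alpha> (int k) * P k 0 $ 2 $ c + ?\<gamma> * d2)"
    have "((\<lambda>x. P (Suc k) x $ 2 $ c) has_real_derivative d) (at 0)"
      unfolding step_product_periodic_Suc(2) add_0_left d_def
      using \<alpha>_pos[of "int k"] by (auto intro!: derivative_eq_intros d1 d2 simp: field_simps)
    moreover have "uniform_limit U (\<lambda>j z. Im (S j (Suc k) z $ 2 $ c) * a (j * N)) (\<lambda>z. \<alpha> 0 * d * Im z) sequentially"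
    proof -
      define \<rho> where "\<rho> j = (if j * N + k = 0 then 1 else a (j * N + k - 1)) / a (j * N + k)" for j
      define \<gamma> where "\<gamma> j z = (z - complex_of_real (b (j * N + k))) / of_real (a (j * N + k))" for j z
      have \<rho>: "uniform_limit U (\<lambda>j _. \<rho> j) (\<lambda>_. ?\<rho>) sequentially"
        using bounded_linear.uniform_limit[OF bounded_linear_Re uniformly_bv_limit[OF ratio_uniformly_bv[of k]]]
        by (simp add: \<rho>_def flip: of_real_divide)
      have \<gamma>: "uniform_limit U (\<lambda>j z. Re (\<gamma> j z)) (\<lambda>_. ?\<gamma>) sequentially"
        using bounded_linear.uniform_limit[OF bounded_linear_Re uniformly_bv_limit[OF coefficient_uniformly_bv[of k]]]
        unfolding \<gamma>_def by simp
      have S2: "uniform_limit U (\<lambda>j z. Re (S j k z $ 2 $ c)) (\<lambda>_. P k 0 $ 2 $ c) sequentially"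
        using bounded_linear.uniform_limit[OF bounded_linear_Re uniformly_bv_limit[OF entries_uniformly_bv[of k, rule_format, of 2 c]]]
        by simp
      have q: "uniform_limit U (\<lambda>j z. a (j * N) / a (j * N + k)) (\<lambda>_. \<alpha> 0 / \<alpha> (int k)) sequentially"
        by (rule uniform_limit_of_tendsto[OF a_quotient_tendsto])
      have bdd_Im: "bounded ((\<lambda>z. x * Im z) ` U)" for x
      proof -
        obtain R where R: "\<And>z. z \<in> U \<Longrightarrow> cmod z \<le> R" using bounded_U by (meson bounded_iff)
        show ?thesis
          by (rule boundedI[where B = "\<bar>x\<bar> * R"])
             (auto simp: abs_mult intro!: mult_left_mono order_trans[OF abs_Im_le_cmod] R)
      qed
      have bdd_const: "bounded ((\<lambda>z. x) ` U)" for x :: real by (auto simp: image_constant_conv)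
      have "uniform_limit U (\<lambda>j z. - \<rho> j * (Im (S j k z $ 1 $ c) * a (j * N)) +
          (1 * Im z * (a (j * N) / a (j * N + k)) * Re (S j k z $ 2 $ c) + Re (\<gamma> j z) * (Im (S j k z $ 2 $ c) * a (j * N))))
        (\<lambda>z. - ?\<rho> * (\<alpha> 0 * d1 * Im z) + (1 * Im z * (\<alpha> 0 / \<alpha> (int k)) * P k 0 $ 2 $ c + ?\<gamma> * (\<alpha> 0 * d2 * Im z))) sequentially"
      proof (intro uniform_limit_add)
        show "uniform_limit U (\<lambda>j z. - \<rho> j * (Im (S j k z $ 1 $ c) * a (j * N))) (\<lambda>z. - ?\<rho> * (\<alpha> 0 * d1 * Im z)) sequentially"
          by (intro uniform_lim_mult uniform_limit_uminus \<rho> d1 bdd_Im bdd_const)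
        show "uniform_limit U (\<lambda>j z. Re (\<gamma> j z) * (Im (S j k z $ 2 $ c) * a (j * N))) (\<lambda>z. ?\<gamma> * (\<alpha> 0 * d2 * Im z)) sequentially"
          by (intro uniform_lim_mult \<gamma> d2 bdd_Im bdd_const)
        have 1: "uniform_limit U (\<lambda>j z. 1 * Im z * (a (j * N) / a (j * N + k))) (\<lambda>z. 1 * Im z * (\<alpha> 0 / \<alpha> (int k))) sequentially"
          by (intro uniform_lim_mult q uniform_limit_const bdd_Im bdd_const)
        show "uniform_limit U (\<lambda>j z. 1 * Im z * (a (j * N) / a (j * N + k)) * Re (S j k z $ 2 $ c))
          (\<lambda>z. 1 * Im z * (\<alpha> 0 / \<alpha> (int k)) * P k 0 $ 2 $ c) sequentially"
          using bdd_Im[of "\<alpha> 0 / \<alpha> (int k)"] by (intro uniform_lim_mult 1 S2 bdd_const) (simp add: mult.commute)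
      qed
      moreover have "- \<rho> j * (Im (S j k z $ 1 $ c) * a (j * N)) +
          (1 * Im z * (a (j * N) / a (j * N + k)) * Re (S j k z $ 2 $ c) + Re (\<gamma> j z) * (Im (S j k z $ 2 $ c) * a (j * N)))
          = Im (S j (Suc k) z $ 2 $ c) * a (j * N)" for j z
      proof -
        have "S j (Suc k) z $ 2 $ c = - of_real (\<rho> j) * S j k z $ 1 $ c + \<gamma> j z * S j k z $ 2 $ c"
          unfolding step_product_transfer_Suc(2) \<rho>_def \<gamma>_def by simp
        moreover have "Im (\<gamma> j z) = Im z / a (j * N + k)"
          unfolding \<gamma>_def by (simp add: Im_divide_of_real)
        ultimately have "Im (S j (Suc k) z $ 2 $ c) = - \<rho> j * Im (S j k z $ 1 $ c)
            + (Re (\<gamma> j z) * Im (S j k z $ 2 $ c) + Im z / a (j * N + k) * Re (S j k z $ 2 $ c))"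
          by (simp del: step_product.simps)
        then show ?thesis by (simp only:) (simp add: algebra_simps)
      qed
      moreover have "- ?\<rho> * (\<alpha> 0 * d1 * Im z) + (1 * Im z * (\<alpha> 0 / \<alpha> (int k)) * P k 0 $ 2 $ c + ?\<gamma> * (\<alpha> 0 * d2 * Im z))
          = \<alpha> 0 * d * Im z" for z
        unfolding d_def by (simp add: divide_inverse algebra_simps)
      ultimately show ?thesis by (simp only:)
    qed
    ultimately show ?thesis by blast
  qed
  show ?case unfolding forall_2 using 1 2 by blast
qed

lemma Im_trace_limit:
  "uniform_limit U (\<lambda>j z. Im (trace (monodromy N a b (j * N) z)) * a (j * N))
     (\<lambda>z. \<alpha> 0 * trace (vector_derivative (periodic_monodromy N \<alpha> \<beta> 0) (at 0)) * Im z) sequentially"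
proof -
  obtain D where D: "\<And>r c. ((\<lambda>x. P N x $ r $ c) has_real_derivative D r c) (at 0)"
    "\<And>r c. uniform_limit U (\<lambda>j z. Im (S j N z $ r $ c) * a (j * N)) (\<lambda>z. \<alpha> 0 * D r c * Im z) sequentially"
    using Im_entries_limit[of N] unfolding choice_iff by blast
  have "vector_derivative (periodic_monodromy N \<alpha> \<beta> 0) (at 0) = (\<chi> r c. D r c)"
    unfolding periodic_monodromy_def by (rule has_real_derivative_entry_imp_vector_derivative[OF D(1)])
  moreover have "uniform_limit U (\<lambda>j z. Im (S j N z $ 1 $ 1) * a (j * N) + Im (S j N z $ 2 $ 2) * a (j * N))
      (\<lambda>z. \<alpha> 0 * D 1 1 * Im z + \<alpha> 0 * D 2 2 * Im z) sequentially"
    by (intro uniform_limit_add D(2))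
  ultimately show ?thesis
    by (simp add: monodromy_def trace_def sum_2 algebra_simps)
qed

end

section \<open>Eigenvalues and eigenvectors of the block matrices\<close>

text \<open>
  For positive \<open>det Y\<close> the argument \<open>w\<close> of \<open>\<xi>\<^sub>+\<close> lies in the upper half-plane together with the
  trace. Both principal roots \<open>sqrt (w - 1)\<close> and \<open>sqrt (w + 1)\<close> then lie in the open first quadrant,
  hence their product lies in the upper half-plane, which singles out the branch of the square
  root of the discriminant.
\<close>

lemma eigenvalue_discriminant:
  fixes Y :: "complex^2^2"
  assumes det: "det Y = complex_of_real d" "d > 0" and Im: "Im (trace Y) > 0"
  obtains \<sigma> where "eig_plus Y = trace Y / 2 + \<sigma>" "eig_minus Y = trace Y / 2 - \<sigma>"
    "\<sigma>\<^sup>2 = (trace Y)\<^sup>2 / 4 - det Y" "Im \<sigma> > 0"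
proof -
  define w where "w = trace Y / (2 * csqrt (det Y))"
  define s where "s = csqrt (w - 1) * csqrt (w + 1)"
  have d: "csqrt (det Y) = complex_of_real (sqrt d)" using det by (simp add: csqrt_of_real_nonneg)
  have "Im w = Im (trace Y) / (2 * sqrt d)" unfolding w_def d
    by (metis Im_divide_of_real of_real_mult of_real_numeral)
  then have Im_w: "Im w > 0" using Im det(2) by simp
  have pos: "Re (csqrt v) > 0 \<and> Im (csqrt v) > 0" if "Im v > 0" for v
  proof -
    have eq: "Im v = 2 * Re (csqrt v) * Im (csqrt v)"
      using arg_cong[OF power2_csqrt[of v], of Im] by (simp add: power2_eq_square mult_ac del: csqrt.simps)
    have "Re (csqrt v) \<ge> 0" using csqrt_principal[of v] by auto
    with eq that show ?thesis by (metis mult_pos_pos mult_zero_left mult_zero_right not_less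
        order_less_le zero_less_mult_iff zero_less_numeral)
  qed
  have Im_s: "Im s > 0" unfolding s_def using pos[of "w - 1"] pos[of "w + 1"] Im_w
    by (simp add: add_pos_pos)
  have s2: "s\<^sup>2 = w\<^sup>2 - 1" unfolding s_def power_mult_distrib power2_csqrt by (simp add: power2_eq_square algebra_simps)
  have dw: "csqrt (det Y) * w = trace Y / 2" unfolding w_def d using det(2) by simp
  show ?thesis
  proof
    show "eig_plus Y = trace Y / 2 + csqrt (det Y) * s"
      unfolding eig_plus_def xi_plus_def w_def[symmetric] s_def[symmetric] dw[symmetric] by (simp add: distrib_left)
    show "eig_minus Y = trace Y / 2 - csqrt (det Y) * s"
      unfolding eig_minus_def xi_minus_def w_def[symmetric] s_def[symmetric] dw[symmetric] by (simp add: right_diff_distrib)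
    have "(csqrt (det Y) * s)\<^sup>2 = (csqrt (det Y) * w)\<^sup>2 - (csqrt (det Y))\<^sup>2"
      unfolding power_mult_distrib s2 by (simp add: algebra_simps)
    then show "(csqrt (det Y) * s)\<^sup>2 = (trace Y)\<^sup>2 / 4 - det Y"
      unfolding dw by (simp add: power_divide)
    show "Im (csqrt (det Y) * s) > 0" unfolding d using Im_s det(2) by simp
  qed
qed

lemma eigenvalue_identities:
  fixes Y :: "complex^2^2"
  assumes "det Y = complex_of_real d" "d > 0" "Im (trace Y) > 0"
  shows "eig_plus Y + eig_minus Y = trace Y" "eig_plus Y * eig_minus Y = det Y"
    "Im (eig_plus Y) > 0"
proof -
  obtain \<sigma> where \<sigma>: "eig_plus Y = trace Y / 2 + \<sigma>" "eig_minus Y = trace Y / 2 - \<sigma>"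
    "\<sigma>\<^sup>2 = (trace Y)\<^sup>2 / 4 - det Y" "Im \<sigma> > 0"
    using eigenvalue_discriminant[OF assms] by blast
  show "eig_plus Y + eig_minus Y = trace Y" by (simp add: \<sigma>)
  have "eig_plus Y * eig_minus Y = (trace Y)\<^sup>2 / 4 - \<sigma>\<^sup>2"
    unfolding \<sigma>(1,2) by (simp add: power2_eq_square algebra_simps)
  then show "eig_plus Y * eig_minus Y = det Y" by (simp add: \<sigma>(3))
  show "Im (eig_plus Y) > 0" using \<sigma>(4) assms(3) by (simp add: \<sigma>(1))
qed

text \<open>
  Let \<open>p\<close> and \<open>m\<close> be the eigenvalues. As \<open>p m\<close> is a positive number, \<open>m = r cnj p\<close> with
  \<open>r = \<bar>m / p\<bar>\<close>, and therefore \<open>Im (p + m) = (1 - r) Im p\<close>. Thus the gap between the moduli is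
  governed by the imaginary part of the trace.
\<close>

lemma eigenvalue_ratio:
  fixes Y :: "complex^2^2"
  assumes "det Y = complex_of_real d" "d > 0" "Im (trace Y) > 0" and C: "cmod (eig_plus Y) \<le> C"
  shows "cmod (eig_minus Y / eig_plus Y) \<le> 1 - Im (trace Y) / C"
proof -
  define p where "p = eig_plus Y"
  define m where "m = eig_minus Y"
  have id: "p + m = trace Y" "p * m = complex_of_real d" "Im p > 0"
    using eigenvalue_identities[OF assms(1-3)] assms(1) by (auto simp: p_def m_def)
  then have p0: "p \<noteq> 0" by auto
  define r where "r = d / (cmod p)\<^sup>2"
  have m_eq: "m = of_real r * cnj p"
  proof -
    have "p * m = p * (of_real r * cnj p)"
      using id(2) p0 complex_norm_square[of p] by (simp add: r_def mult.commute mult.left_commute)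
    then show ?thesis using p0 by simp
  qed
  have r: "r > 0" unfolding r_def using p0 assms(2) by simp
  have norm: "cmod (m / p) = r" using p0 r by (simp add: m_eq norm_divide norm_mult)
  have Im_t: "Im (trace Y) = Im p * (1 - r)"
    unfolding id(1)[symmetric] by (simp add: m_eq algebra_simps)
  have "Im p \<le> C" using abs_Im_le_cmod[of p] C by (simp add: p_def)
  then have "Im (trace Y) / C \<le> Im (trace Y) / Im p"
    using assms(3) id(3) by (intro divide_left_mono) auto
  also have "\<dots> = 1 - r" using id(3) by (simp add: Im_t)
  finally show ?thesis using norm by (simp add: p_def m_def)
qed

lemma step_product_entry_holomorphic:
  "\<forall>r c. (\<lambda>z. step_product (transfer a b) n k z $ r $ c) holomorphic_on A"
proof (induction k)
  case 0
  show ?case by simp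
next
  case (Suc k)
  have 1: "(\<lambda>z. step_product (transfer a b) n (Suc k) z $ 1 $ c) holomorphic_on A" for c
    unfolding step_product_transfer_Suc(1) using Suc by blast
  have 2: "(\<lambda>z. step_product (transfer a b) n (Suc k) z $ 2 $ c) holomorphic_on A" for c
    unfolding step_product_transfer_Suc(2) divide_inverse using Suc by (auto intro!: holomorphic_intros)
  show ?case unfolding forall_2 using 1 2 by blast
qed

text \<open>
  The last assumption says that \<open>U\<close> keeps a positive distance from the real axis, inside the
  half-plane determined by the sign of the derivative of the trace.
\<close>

locale oscillatory_jacobi = modulated_jacobi +
  fixes c0 :: real
  assumes open_U: "open U" and nonempty_U: "U \<noteq> {}"
    and elliptic: "trace (periodic_monodromy N \<alpha> \<beta> 0 0) \<in> {-2<..<2}"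
    and carleman: "\<not> summable (\<lambda>n. 1 / a n)"
    and c0: "c0 > 0"
    and half_plane: "\<And>z. z \<in> U \<Longrightarrow> trace (vector_derivative (periodic_monodromy N \<alpha> \<beta> 0) (at 0)) * Im z \<ge> c0"
begin

text \<open>
  For a matrix \<open>Y\<close> with \<open>Y $ 1 $ 2 \<noteq> 0\<close> the eigenvector for the eigenvalue \<open>\<lambda>\<close> is \<open>(1, \<mu>)\<close> with
  \<open>\<mu> = (\<lambda> - Y $ 1 $ 1) / Y $ 1 $ 2\<close>. Thus \<open>\<mu>p\<close> and \<open>\<mu>m\<close> are the slopes of the eigenlines, \<open>\<Delta>\<close> is the
  determinant of the eigenbasis, and \<open>\<i> * \<kappa>\<close> is the limit of half the difference of the
  eigenvalues.
\<close>

definition Y where "Y j z = monodromy N a b (j * N) z"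
definition \<Lambda>p where "\<Lambda>p j z = eig_plus (Y j z)"
definition \<Lambda>m where "\<Lambda>m j z = eig_minus (Y j z)"
definition \<mu>p where "\<mu>p j z = (\<Lambda>p j z - Y j z $ 1 $ 1) / Y j z $ 1 $ 2"
definition \<mu>m where "\<mu>m j z = (\<Lambda>m j z - Y j z $ 1 $ 1) / Y j z $ 1 $ 2"
definition \<Delta> where "\<Delta> j z = \<mu>m j z - \<mu>p j z"
definition q where "q j z = \<Lambda>m j z / \<Lambda>p j z"
definition \<kappa> where "\<kappa> = sqrt (1 - (trace (P N 0))\<^sup>2 / 4)"

lemma Y_uniformly_bv: "uniformly_bv U (\<lambda>j z. Y j z $ r $ c) (of_real (P N 0 $ r $ c))"
  unfolding Y_def monodromy_def using entries_uniformly_bv by blast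

lemma Y_holomorphic: "(\<lambda>z. Y j z $ r $ c) holomorphic_on U"
  unfolding Y_def monodromy_def using step_product_entry_holomorphic by blast

lemma det_Y: obtains d where "d > 0" "det (Y j z) = complex_of_real d"
  using det_step_product_transfer[of a b "j * N" N z, OF a_pos] unfolding Y_def monodromy_def by blast

lemma trace_P: "\<bar>trace (P N 0)\<bar> < 2"
  using elliptic unfolding periodic_monodromy_def by auto

lemma det_P: "det (P N 0) = 1"
proof -
  have "\<alpha> (int N - 1) = \<alpha> (-1)" using periodic_seq_shift[OF \<alpha>_per, of "-1" 1] by simp
  then show ?thesis using \<alpha>_nonzero by (simp add: det_step_product_periodic[OF \<alpha>_pos])
qed

text \<open>
  With a vanishing off-diagonal entry the limit matrix would have real eigenvalues with product
  \<open>1\<close>, hence a trace of modulus at least \<open>2\<close>.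
\<close>

lemma P12_nonzero: "P N 0 $ 1 $ 2 \<noteq> 0"
proof
  assume "P N 0 $ 1 $ 2 = 0"
  then have "P N 0 $ 1 $ 1 * P N 0 $ 2 $ 2 = 1" using det_P by (simp add: det_2)
  moreover have "trace (P N 0) = P N 0 $ 1 $ 1 + P N 0 $ 2 $ 2" by (simp add: trace_def sum_2)
  ultimately have "(trace (P N 0))\<^sup>2 = (P N 0 $ 1 $ 1 - P N 0 $ 2 $ 2)\<^sup>2 + 4"
    by (simp add: power2_eq_square algebra_simps)
  then have "(trace (P N 0))\<^sup>2 \<ge> 2\<^sup>2" by simp
  then show False using trace_P by (metis abs_le_square_iff abs_numeral not_le)
qed

lemma \<kappa>: "\<kappa> > 0" "\<kappa>\<^sup>2 = 1 - (trace (P N 0))\<^sup>2 / 4"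
proof -
  have "\<bar>trace (P N 0)\<bar>\<^sup>2 < 2\<^sup>2" using trace_P by (intro power_strict_mono) auto
  then have "(trace (P N 0))\<^sup>2 < 2\<^sup>2" by simp
  then have "1 - (trace (P N 0))\<^sup>2 / 4 > 0" by simp
  then show "\<kappa> > 0" "\<kappa>\<^sup>2 = 1 - (trace (P N 0))\<^sup>2 / 4" by (simp_all add: \<kappa>_def)
qed

lemma Im_trace_lower_bound:
  "\<forall>\<^sub>F j in sequentially. \<forall>z\<in>U. Im (trace (Y j z)) \<ge> \<alpha> 0 * c0 / 2 / a (j * N)"
proof -
  have "\<alpha> 0 * c0 / 2 > 0" using c0 \<alpha>_pos[of 0] by simp
  from uniform_limitD[OF Im_trace_limit this] show ?thesis
  proof eventually_elim
    case (elim j)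
    show ?case
    proof
      fix z assume z: "z \<in> U"
      have "\<alpha> 0 * c0 \<le> \<alpha> 0 * (trace (vector_derivative (periodic_monodromy N \<alpha> \<beta> 0) (at 0)) * Im z)"
        using half_plane[OF z] \<alpha>_pos[of 0] by (intro mult_left_mono) auto
      then have "\<alpha> 0 * c0 / 2 \<le> Im (trace (Y j z)) * a (j * N)"
        using bspec[OF elim z] unfolding Y_def[symmetric] dist_real_def abs_less_iff mult.assoc by linarith
      then show "Im (trace (Y j z)) \<ge> \<alpha> 0 * c0 / 2 / a (j * N)"
        using a_pos[of "j * N"] by (simp add: divide_le_eq)
    qed
  qed
qed

lemma Im_trace_pos: "\<forall>\<^sub>F j in sequentially. \<forall>z\<in>U. Im (trace (Y j z)) > 0"
  using Im_trace_lower_bound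
proof eventually_elim
  case (elim j)
  have "\<alpha> 0 * c0 / 2 / a (j * N) > 0" using c0 \<alpha>_pos[of 0] a_pos[of "j * N"] by simp
  with elim show ?case by force
qed

lemma trace_uniformly_bv: "uniformly_bv U (\<lambda>j z. trace (Y j z)) (of_real (trace (P N 0)))"
  using uniformly_bv_add[OF Y_uniformly_bv[of 1 1] Y_uniformly_bv[of 2 2]] by (simp add: trace_def sum_2)

lemma det_uniformly_bv: "uniformly_bv U (\<lambda>j z. det (Y j z)) 1"
proof -
  have "uniformly_bv U (\<lambda>j z. Y j z $ 1 $ 1 * Y j z $ 2 $ 2 - Y j z $ 1 $ 2 * Y j z $ 2 $ 1)
     (of_real (P N 0 $ 1 $ 1) * of_real (P N 0 $ 2 $ 2) - of_real (P N 0 $ 1 $ 2) * of_real (P N 0 $ 2 $ 1))"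
    by (intro uniformly_bv_diff uniformly_bv_mult Y_uniformly_bv)
  moreover have "of_real (P N 0 $ 1 $ 1) * of_real (P N 0 $ 2 $ 2) - of_real (P N 0 $ 1 $ 2) * of_real (P N 0 $ 2 $ 1)
     = complex_of_real (det (P N 0))"
    by (simp only: det_2 of_real_diff of_real_mult)
  moreover have "Y j z $ 1 $ 1 * Y j z $ 2 $ 2 - Y j z $ 1 $ 2 * Y j z $ 2 $ 1 = det (Y j z)" for j z
    by (rule det_2[symmetric])
  ultimately show ?thesis by (simp only: det_P of_real_1)
qed

lemma discriminant_uniformly_bv:
  "uniformly_bv U (\<lambda>j z. \<Lambda>p j z - trace (Y j z) / 2) (\<i> * of_real \<kappa>)"
proof (rule uniformly_bv_square_root)
  have bv: "uniformly_bv U (\<lambda>j z. trace (Y j z) * trace (Y j z) * (1/4) - det (Y j z))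
      (of_real (trace (P N 0)) * of_real (trace (P N 0)) * (1/4) - 1)"
    by (intro uniformly_bv_diff uniformly_bv_mult trace_uniformly_bv det_uniformly_bv uniformly_bv_const)
  have lim: "of_real (trace (P N 0)) * of_real (trace (P N 0)) * (1/4) - 1 = - complex_of_real (\<kappa>\<^sup>2)"
    unfolding \<kappa>(2) by (simp add: power2_eq_square)
  have eq: "\<forall>\<^sub>F j in sequentially. \<forall>z\<in>U.
      trace (Y j z) * trace (Y j z) * (1/4) - det (Y j z) = (\<Lambda>p j z - trace (Y j z) / 2)\<^sup>2"
    using Im_trace_pos
  proof eventually_elim
    case (elim j)
    show ?case
    proof
      fix z assume z: "z \<in> U"
      obtain d where "d > 0" "det (Y j z) = complex_of_real d" by (rule det_Y)
      with elim z obtain \<sigma> where "eig_plus (Y j z) = trace (Y j z) / 2 + \<sigma>" "\<sigma>\<^sup>2 = (trace (Y j z))\<^sup>2 / 4 - det (Y j z)"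
        using eigenvalue_discriminant[of "Y j z" d] by blast
      then show "trace (Y j z) * trace (Y j z) * (1/4) - det (Y j z) = (\<Lambda>p j z - trace (Y j z) / 2)\<^sup>2"
        by (simp add: \<Lambda>p_def power2_eq_square)
    qed
  qed
  show "uniformly_bv U (\<lambda>j z. (\<Lambda>p j z - trace (Y j z) / 2)\<^sup>2) (- complex_of_real (\<kappa>\<^sup>2))"
    by (rule uniformly_bv_cong[OF bv[unfolded lim] eq])
  show "\<forall>\<^sub>F j in sequentially. \<forall>z\<in>U. Im (\<Lambda>p j z - trace (Y j z) / 2) \<ge> 0"
    using Im_trace_pos
  proof eventually_elim
    case (elim j)
    show ?case
    proof
      fix z assume z: "z \<in> U"
      obtain d where "d > 0" "det (Y j z) = complex_of_real d" by (rule det_Y)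
      with elim z obtain \<sigma> where "eig_plus (Y j z) = trace (Y j z) / 2 + \<sigma>" "Im \<sigma> > 0"
        using eigenvalue_discriminant[of "Y j z" d] by blast
      then show "Im (\<Lambda>p j z - trace (Y j z) / 2) \<ge> 0" by (simp add: \<Lambda>p_def)
    qed
  qed
qed (rule \<kappa>)

abbreviation \<Lambda>p_lim :: complex where "\<Lambda>p_lim \<equiv> of_real (trace (P N 0)) * (1/2) + \<i> * of_real \<kappa>"
abbreviation \<Lambda>m_lim :: complex where "\<Lambda>m_lim \<equiv> of_real (trace (P N 0)) * (1/2) - \<i> * of_real \<kappa>"
abbreviation \<mu>p_lim :: complex where "\<mu>p_lim \<equiv> (\<Lambda>p_lim - of_real (P N 0 $ 1 $ 1)) / of_real (P N 0 $ 1 $ 2)"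
abbreviation \<mu>m_lim :: complex where "\<mu>m_lim \<equiv> (\<Lambda>m_lim - of_real (P N 0 $ 1 $ 1)) / of_real (P N 0 $ 1 $ 2)"

lemma \<Lambda>p_uniformly_bv: "uniformly_bv U \<Lambda>p \<Lambda>p_lim"
  using uniformly_bv_add[OF uniformly_bv_mult[OF trace_uniformly_bv uniformly_bv_const[of _ "1/2"]] discriminant_uniformly_bv]
  by simp

lemma \<Lambda>m_uniformly_bv: "uniformly_bv U \<Lambda>m \<Lambda>m_lim"
proof (rule uniformly_bv_cong)
  show "uniformly_bv U (\<lambda>j z. trace (Y j z) * (1/2) - (\<Lambda>p j z - trace (Y j z) / 2)) \<Lambda>m_lim"
    by (intro uniformly_bv_diff uniformly_bv_mult trace_uniformly_bv uniformly_bv_const discriminant_uniformly_bv)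
  show "\<forall>\<^sub>F j in sequentially. \<forall>z\<in>U. trace (Y j z) * (1/2) - (\<Lambda>p j z - trace (Y j z) / 2) = \<Lambda>m j z"
    using Im_trace_pos
  proof eventually_elim
    case (elim j)
    show ?case
    proof
      fix z assume z: "z \<in> U"
      obtain d where "d > 0" "det (Y j z) = complex_of_real d" by (rule det_Y)
      then have "\<Lambda>p j z + \<Lambda>m j z = trace (Y j z)"
        unfolding \<Lambda>p_def \<Lambda>m_def using elim z by (intro eigenvalue_identities) auto
      then show "trace (Y j z) * (1/2) - (\<Lambda>p j z - trace (Y j z) / 2) = \<Lambda>m j z"
        by (simp add: algebra_simps)
    qed
  qed
qed

lemma \<mu>p_uniformly_bv: "uniformly_bv U \<mu>p \<mu>p_lim" and \<mu>m_uniformly_bv: "uniformly_bv U \<mu>m \<mu>m_lim"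
  unfolding \<mu>p_def[abs_def] \<mu>m_def[abs_def] using P12_nonzero
  by (intro uniformly_bv_divide uniformly_bv_diff Y_uniformly_bv \<Lambda>p_uniformly_bv \<Lambda>m_uniformly_bv; simp)+

lemma \<Delta>_limit: "uniform_limit U \<Delta> (\<lambda>_. \<mu>m_lim - \<mu>p_lim) sequentially" "\<mu>m_lim - \<mu>p_lim \<noteq> 0"
proof -
  show "uniform_limit U \<Delta> (\<lambda>_. \<mu>m_lim - \<mu>p_lim) sequentially"
    unfolding \<Delta>_def[abs_def] by (intro uniform_limit_minus uniformly_bv_limit \<mu>p_uniformly_bv \<mu>m_uniformly_bv)
  have "\<mu>m_lim - \<mu>p_lim = - 2 * \<i> * of_real \<kappa> / of_real (P N 0 $ 1 $ 2)"
    by (simp add: diff_divide_distrib[symmetric])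
  then show "\<mu>m_lim - \<mu>p_lim \<noteq> 0" using \<kappa>(1) P12_nonzero by simp
qed

text \<open>
  The first row of the eigenvalue equation is the definition of the slope; the second one follows
  from the characteristic equation after division by \<open>Y $ 1 $ 2\<close>.
\<close>

lemma eigenvectors:
  assumes Im: "Im (trace (Y j z)) > 0" and Y12: "Y j z $ 1 $ 2 \<noteq> 0"
  shows "Y j z $ 1 $ 1 + Y j z $ 1 $ 2 * \<mu>p j z = \<Lambda>p j z"
    "Y j z $ 2 $ 1 + Y j z $ 2 $ 2 * \<mu>p j z = \<Lambda>p j z * \<mu>p j z"
    "Y j z $ 1 $ 1 + Y j z $ 1 $ 2 * \<mu>m j z = \<Lambda>m j z"
    "Y j z $ 2 $ 1 + Y j z $ 2 $ 2 * \<mu>m j z = \<Lambda>m j z * \<mu>m j z"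
    "\<Lambda>p j z \<noteq> 0" "\<Lambda>m j z \<noteq> 0"
proof -
  obtain d where d: "d > 0" "det (Y j z) = complex_of_real d" by (rule det_Y)
  have sum: "\<Lambda>p j z + \<Lambda>m j z = Y j z $ 1 $ 1 + Y j z $ 2 $ 2"
    and prod: "\<Lambda>p j z * \<Lambda>m j z = Y j z $ 1 $ 1 * Y j z $ 2 $ 2 - Y j z $ 1 $ 2 * Y j z $ 2 $ 1"
    unfolding \<Lambda>p_def \<Lambda>m_def
    using eigenvalue_identities[OF d(2,1) Im] by (simp_all add: trace_def sum_2 det_2)
  have "\<Lambda>p j z * \<Lambda>m j z = of_real d" unfolding \<Lambda>p_def \<Lambda>m_def using eigenvalue_identities[OF d(2,1) Im] d by simp
  then show "\<Lambda>p j z \<noteq> 0" "\<Lambda>m j z \<noteq> 0" using d(1) by auto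
  show 1: "Y j z $ 1 $ 1 + Y j z $ 1 $ 2 * \<mu>p j z = \<Lambda>p j z"
    and 2: "Y j z $ 1 $ 1 + Y j z $ 1 $ 2 * \<mu>m j z = \<Lambda>m j z"
    using Y12 by (simp_all add: \<mu>p_def \<mu>m_def)
  have row2: "y21 + y22 * \<mu> = l * \<mu>" if l: "l + l' = y11 + y22" "l * l' = y11 * y22 - y12 * y21"
    "y11 + y12 * \<mu> = l" "y12 \<noteq> 0" for y11 y12 y21 y22 \<mu> l l' :: complex
  proof -
    have "y12 * (y21 + y22 * \<mu> - l * \<mu>) = 0" using l by algebra
    with \<open>y12 \<noteq> 0\<close> show ?thesis by simp
  qed
  show "Y j z $ 2 $ 1 + Y j z $ 2 $ 2 * \<mu>p j z = \<Lambda>p j z * \<mu>p j z"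
    using row2[OF sum prod 1 Y12] .
  show "Y j z $ 2 $ 1 + Y j z $ 2 $ 2 * \<mu>m j z = \<Lambda>m j z * \<mu>m j z"
    by (rule row2[OF _ _ 2 Y12, of "\<Lambda>p j z"]) (use sum prod in \<open>simp_all add: add.commute mult.commute\<close>)
qed

lemma eigenvalue_holomorphic:
  assumes "\<forall>z\<in>U. Im (trace (Y j z)) > 0"
  shows "\<Lambda>p j holomorphic_on U" "\<Lambda>m j holomorphic_on U"
proof -
  have tr: "(\<lambda>z. trace (Y j z)) holomorphic_on U"
    by (simp only: trace_def sum_2) (intro holomorphic_on_add Y_holomorphic)
  have det: "(\<lambda>z. det (Y j z)) holomorphic_on U"
    by (simp only: det_2) (intro holomorphic_on_diff holomorphic_on_mult Y_holomorphic)
  have sq: "(\<lambda>z. csqrt (det (Y j z))) holomorphic_on U"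
  proof (intro holomorphic_on_csqrt' det)
    fix z
    show "det (Y j z) \<notin> \<real>\<^sub>\<le>\<^sub>0" by (rule det_Y[of j z]) auto
  qed
  have sq_nz: "csqrt (det (Y j z)) \<noteq> 0" for z by (rule det_Y[of j z]) auto
  define w where "w z = trace (Y j z) / (2 * csqrt (det (Y j z)))" for z
  have w: "w holomorphic_on U" unfolding w_def[abs_def]
    using sq_nz by (intro holomorphic_intros tr sq) auto
  have Im_w: "Im (w z) > 0" if "z \<in> U" for z
  proof -
    obtain d where d: "d > 0" "det (Y j z) = complex_of_real d" by (rule det_Y)
    then have "csqrt (det (Y j z)) = complex_of_real (sqrt d)" by (simp add: csqrt_of_real_nonneg)
    then have "Im (w z) = Im (trace (Y j z)) / (2 * sqrt d)"
      unfolding w_def by (metis Im_divide_of_real of_real_mult of_real_numeral)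
    then show ?thesis using assms that d(1) by simp
  qed
  have not_neg: "v \<notin> \<real>\<^sub>\<le>\<^sub>0" if "Im v > 0" for v using that by (auto simp: complex_nonpos_Reals_iff)
  have roots: "(\<lambda>z. csqrt (w z - 1)) holomorphic_on U" "(\<lambda>z. csqrt (w z + 1)) holomorphic_on U"
    using Im_w by (auto intro!: holomorphic_on_csqrt' holomorphic_intros w not_neg)
  show "\<Lambda>p j holomorphic_on U" "\<Lambda>m j holomorphic_on U"
    unfolding \<Lambda>p_def[abs_def] \<Lambda>m_def[abs_def] eig_plus_def eig_minus_def xi_plus_def xi_minus_def w_def[symmetric]
    by (intro holomorphic_intros sq w roots)+
qed

end

text \<open>
  Here \<open>M\<close> is a time after which all asymptotic estimates hold for every \<open>z\<close> in \<open>U\<close>: the two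
  eigenvalues are separated in modulus by the non-summable \<open>\<delta>\<close>, and the eigenlines rotate,
  measured against the determinant of the eigenbasis at either end of a step, by the summable
  \<open>e\<close>, whose remaining sum is small.
\<close>

locale dichotomy = oscillatory_jacobi +
  fixes M :: nat and e \<delta> :: "nat \<Rightarrow> real"
  assumes M: "M \<ge> 1"
    and Im_trace_M: "\<And>j z. j \<ge> M \<Longrightarrow> z \<in> U \<Longrightarrow> Im (trace (Y j z)) > 0"
    and Y12_M: "\<And>j z. j \<ge> M \<Longrightarrow> z \<in> U \<Longrightarrow> Y j z $ 1 $ 2 \<noteq> 0"
    and \<Delta>_M: "\<And>j z. j \<ge> M \<Longrightarrow> z \<in> U \<Longrightarrow> \<Delta> j z \<noteq> 0"
    and q_M: "\<And>j z. j \<ge> M \<Longrightarrow> z \<in> U \<Longrightarrow> cmod (q j z) \<le> 1 - \<delta> j"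
    and \<delta>_M: "\<And>j. j \<ge> M \<Longrightarrow> 0 \<le> \<delta> j" "\<And>j. j \<ge> M \<Longrightarrow> \<delta> j \<le> 1" "\<not> summable \<delta>"
    and \<mu>_M: "\<And>j z. j \<ge> M \<Longrightarrow> z \<in> U \<Longrightarrow> cmod (\<mu>p j z - \<mu>p (Suc j) z) \<le> e j * cmod (\<Delta> j z)"
      "\<And>j z. j \<ge> M \<Longrightarrow> z \<in> U \<Longrightarrow> cmod (\<mu>m j z - \<mu>m (Suc j) z) \<le> e j * cmod (\<Delta> j z)"
      "\<And>j z. j \<ge> M \<Longrightarrow> z \<in> U \<Longrightarrow> cmod (\<mu>p j z - \<mu>p (Suc j) z) \<le> e j * cmod (\<Delta> (Suc j) z)"
      "\<And>j z. j \<ge> M \<Longrightarrow> z \<in> U \<Longrightarrow> cmod (\<mu>m j z - \<mu>m (Suc j) z) \<le> e j * cmod (\<Delta> (Suc j) z)"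
    and e_M: "\<And>j. j \<ge> M \<Longrightarrow> 0 \<le> e j" "summable e" "(\<Sum>i. e (i + M)) \<le> 1/8"

text \<open>
  The separation \<open>\<delta> j\<close> is a multiple of \<open>1 / a (j N)\<close>, since this is the size of the imaginary
  part of the trace; Carleman's condition makes it non-summable.
\<close>

lemma (in oscillatory_jacobi) uniform_dichotomy:
  "\<exists>M e \<delta>. dichotomy N a b \<alpha> \<beta> U c0 M e \<delta>"
proof -
  obtain gp where gp: "summable gp" "\<forall>\<^sub>F j in sequentially. \<forall>z\<in>U. cmod (\<mu>p (Suc j) z - \<mu>p j z) \<le> gp j"
    using uniformly_bvE[OF \<mu>p_uniformly_bv] .
  obtain gm where gm: "summable gm" "\<forall>\<^sub>F j in sequentially. \<forall>z\<in>U. cmod (\<mu>m (Suc j) z - \<mu>m j z) \<le> gm j"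
    using uniformly_bvE[OF \<mu>m_uniformly_bv] .
  define D where "D = cmod (\<mu>m_lim - \<mu>p_lim) / 2"
  have D: "D > 0" unfolding D_def using \<Delta>_limit(2) by (simp only: zero_less_divide_iff zero_less_norm_iff) simp
  have \<Delta>_ge: "\<forall>\<^sub>F j in sequentially. \<forall>z\<in>U. D \<le> cmod (\<Delta> j z)"
    unfolding D_def by (rule uniform_limit_norm_lower_bound[OF \<Delta>_limit])
  define e where "e j = (gp j + gm j) / D" for j
  have e_sum: "summable e" unfolding e_def[abs_def] by (intro summable_divide summable_add gp gm)
  define C where "C = cmod \<Lambda>p_lim + 1"
  have C: "C > 0" unfolding C_def by (simp add: add_nonneg_pos)
  have C_bound: "\<forall>\<^sub>F j in sequentially. \<forall>z\<in>U. cmod (\<Lambda>p j z) \<le> C"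
    unfolding C_def by (rule uniform_limit_norm_bound[OF uniformly_bv_limit[OF \<Lambda>p_uniformly_bv]])
  define k where "k = \<alpha> 0 * c0 / 2 / C"
  have k: "k > 0" unfolding k_def using C c0 \<alpha>_pos[of 0] by simp
  define \<delta> where "\<delta> j = k * (1 / a (j * N))" for j
  have \<delta>_ns: "\<not> summable \<delta>"
    unfolding \<delta>_def[abs_def] using not_summable_block[OF carleman] k
    by (simp only: summable_cmult_iff) simp
  have "\<delta> \<longlonglongrightarrow> k * 0" unfolding \<delta>_def[abs_def] using inverse_a_tendsto_0[of 0] by (intro tendsto_mult_left) simp
  then have \<delta>_le: "\<forall>\<^sub>F j in sequentially. \<delta> j < 1" by (intro order_tendstoD(2)[of _ "k * 0"]) auto
  have Y12: "\<forall>\<^sub>F j in sequentially. \<forall>z\<in>U. cmod (of_real (P N 0 $ 1 $ 2)) / 2 \<le> cmod (Y j z $ 1 $ 2)"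
    using P12_nonzero by (intro uniform_limit_norm_lower_bound uniformly_bv_limit Y_uniformly_bv) simp
  obtain n0 where n0: "norm (\<Sum>i. e (i + n)) < 1/8" if "n \<ge> n0" for n
    using suminf_exist_split[OF _ e_sum, of "1/8"] by auto
  have "\<forall>\<^sub>F j in sequentially. (\<forall>z\<in>U. Im (trace (Y j z)) > 0) \<and> (\<forall>z\<in>U. Y j z $ 1 $ 2 \<noteq> 0)
      \<and> (\<forall>z\<in>U. \<Delta> j z \<noteq> 0) \<and> (\<forall>z\<in>U. cmod (q j z) \<le> 1 - \<delta> j) \<and> \<delta> j \<le> 1
      \<and> (\<forall>z\<in>U. cmod (\<mu>p j z - \<mu>p (Suc j) z) \<le> e j * cmod (\<Delta> j z))
      \<and> (\<forall>z\<in>U. cmod (\<mu>m j z - \<mu>m (Suc j) z) \<le> e j * cmod (\<Delta> j z))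
      \<and> (\<forall>z\<in>U. cmod (\<mu>p j z - \<mu>p (Suc j) z) \<le> e j * cmod (\<Delta> (Suc j) z))
      \<and> (\<forall>z\<in>U. cmod (\<mu>m j z - \<mu>m (Suc j) z) \<le> e j * cmod (\<Delta> (Suc j) z)) \<and> e j \<ge> 0"
    using Im_trace_lower_bound Im_trace_pos Y12 \<Delta>_ge eventually_Suc[OF \<Delta>_ge] C_bound \<delta>_le gp(2) gm(2)
  proof eventually_elim
    case (elim j)
    have nonneg: "gp j \<ge> 0" "gm j \<ge> 0"
      using nonempty_U elim(8,9) by (meson ex_in_conv norm_ge_zero order_trans)+
    have e: "e j \<ge> 0" unfolding e_def using nonneg D by simp
    have diff: "cmod (\<mu>p j z - \<mu>p (Suc j) z) \<le> e j * D" "cmod (\<mu>m j z - \<mu>m (Suc j) z) \<le> e j * D" if "z \<in> U" for z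
      using bspec[OF elim(8) that] bspec[OF elim(9) that] nonneg D
      by (auto simp: e_def norm_minus_commute)
    have eD: "e j * D \<le> e j * cmod (\<Delta> j z)" "e j * D \<le> e j * cmod (\<Delta> (Suc j) z)" if "z \<in> U" for z
      using elim(4,5) that e by (auto intro: mult_left_mono)
    have q: "cmod (q j z) \<le> 1 - \<delta> j" if z: "z \<in> U" for z
    proof -
      obtain d where d: "d > 0" "det (Y j z) = complex_of_real d" by (rule det_Y)
      have "cmod (q j z) \<le> 1 - Im (trace (Y j z)) / C"
        unfolding q_def \<Lambda>p_def \<Lambda>m_def using elim(2,6) z d
        by (intro eigenvalue_ratio) (auto simp: \<Lambda>p_def)
      moreover have "\<delta> j = (\<alpha> 0 * c0 / 2 / a (j * N)) / C" by (simp add: \<delta>_def k_def mult.commute)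
      then have "\<delta> j \<le> Im (trace (Y j z)) / C"
        using elim(1) z C by (simp only:) (intro divide_right_mono, auto)
      ultimately show ?thesis by linarith
    qed
    have "Y j z $ 1 $ 2 \<noteq> 0" "\<Delta> j z \<noteq> 0" if "z \<in> U" for z
      using bspec[OF elim(3) that] bspec[OF elim(4) that] P12_nonzero D by auto
    then show ?case
      using elim(2,7) q e order_trans[OF diff(1) eD(1)] order_trans[OF diff(1) eD(2)]
        order_trans[OF diff(2) eD(1)] order_trans[OF diff(2) eD(2)]
      by auto
  qed
  then obtain M0 where M0: "\<And>j. j \<ge> M0 \<Longrightarrow> (\<forall>z\<in>U. Im (trace (Y j z)) > 0) \<and> (\<forall>z\<in>U. Y j z $ 1 $ 2 \<noteq> 0)
      \<and> (\<forall>z\<in>U. \<Delta> j z \<noteq> 0) \<and> (\<forall>z\<in>U. cmod (q j z) \<le> 1 - \<delta> j) \<and> \<delta> j \<le> 1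
      \<and> (\<forall>z\<in>U. cmod (\<mu>p j z - \<mu>p (Suc j) z) \<le> e j * cmod (\<Delta> j z))
      \<and> (\<forall>z\<in>U. cmod (\<mu>m j z - \<mu>m (Suc j) z) \<le> e j * cmod (\<Delta> j z))
      \<and> (\<forall>z\<in>U. cmod (\<mu>p j z - \<mu>p (Suc j) z) \<le> e j * cmod (\<Delta> (Suc j) z))
      \<and> (\<forall>z\<in>U. cmod (\<mu>m j z - \<mu>m (Suc j) z) \<le> e j * cmod (\<Delta> (Suc j) z)) \<and> e j \<ge> 0"
    unfolding eventually_sequentially by blast
  define M where "M = max 1 (max M0 n0)"
  have M: "M \<ge> 1" "M \<ge> M0" "M \<ge> n0" by (auto simp: M_def)
  have \<delta>_nonneg: "\<delta> j \<ge> 0" for j unfolding \<delta>_def using k a_pos[of "j * N"] by simp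
  have tail: "(\<Sum>i. e (i + M)) \<le> 1/8" using n0[OF M(3)] by simp
  show ?thesis
  proof (intro exI, unfold_locales)
    note G = M0[OF order_trans[OF M(2)]]
    show "M \<ge> 1" by (rule M(1))
    show "\<not> summable \<delta>" "summable e" "(\<Sum>i. e (i + M)) \<le> 1/8" by (fact \<delta>_ns e_sum tail)+
    show "Im (trace (Y j z)) > 0" if "j \<ge> M" "z \<in> U" for j z using G[OF that(1)] that(2) by blast
    show "Y j z $ 1 $ 2 \<noteq> 0" if "j \<ge> M" "z \<in> U" for j z using G[OF that(1)] that(2) by blast
    show "\<Delta> j z \<noteq> 0" if "j \<ge> M" "z \<in> U" for j z using G[OF that(1)] that(2) by blast
    show "cmod (q j z) \<le> 1 - \<delta> j" if "j \<ge> M" "z \<in> U" for j z using G[OF that(1)] that(2) by blast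
    show "cmod (\<mu>p j z - \<mu>p (Suc j) z) \<le> e j * cmod (\<Delta> j z)" if "j \<ge> M" "z \<in> U" for j z using G[OF that(1)] that(2) by blast
    show "cmod (\<mu>m j z - \<mu>m (Suc j) z) \<le> e j * cmod (\<Delta> j z)" if "j \<ge> M" "z \<in> U" for j z using G[OF that(1)] that(2) by blast
    show "cmod (\<mu>p j z - \<mu>p (Suc j) z) \<le> e j * cmod (\<Delta> (Suc j) z)" if "j \<ge> M" "z \<in> U" for j z using G[OF that(1)] that(2) by blast
    show "cmod (\<mu>m j z - \<mu>m (Suc j) z) \<le> e j * cmod (\<Delta> (Suc j) z)" if "j \<ge> M" "z \<in> U" for j z using G[OF that(1)] that(2) by blast
    show "0 \<le> \<delta> j" for j by (rule \<delta>_nonneg)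
    show "\<delta> j \<le> 1" "0 \<le> e j" if "j \<ge> M" for j using G[OF that] by blast+
  qed
qed

section \<open>Generalized eigenvectors with prescribed data\<close>

lemma uniform_limit_shift_iff:
  "uniform_limit U (\<lambda>k. f (k + M)) g sequentially \<longleftrightarrow> uniform_limit U f g sequentially"
  unfolding uniform_limit_iff
  by (simp only: eventually_sequentially_seg[of "\<lambda>n. \<forall>x\<in>U. dist (f n x) (g x) < e" M for e])

text \<open>
  Solve for the initial vector \<open>\<eta>\<close> by Cramer's rule. The determinant of the product of transfer
  matrices is a positive number, so \<open>\<eta>\<close>, and with it the whole solution, depends holomorphically
  on \<open>z\<close>.
\<close>

lemma prescribed_eigenvector:
  fixes p r :: "complex \<Rightarrow> complex"
  assumes a_pos: "\<And>n. a n > 0" and m: "m \<ge> 1"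
    and hol: "p holomorphic_on U" "r holomorphic_on U" and nz: "\<And>z. z \<in> U \<Longrightarrow> p z \<noteq> 0 \<or> r z \<noteq> 0"
  obtains u where "\<And>n. u n holomorphic_on U" "\<And>z. z \<in> U \<Longrightarrow> gen_eigenvector a b z (\<lambda>n. u n z)"
    "\<And>z. z \<in> U \<Longrightarrow> u (m - 1) z = p z" "\<And>z. z \<in> U \<Longrightarrow> u m z = r z"
proof -
  define S where "S n z = step_product (transfer a b) 0 n z" for n z
  have S_hol: "(\<lambda>z. S n z $ i $ j) holomorphic_on U" for n i j
    unfolding S_def using step_product_entry_holomorphic by blast
  have det_nz: "det (S n z) \<noteq> 0" for n z
    using det_step_product_transfer[of a b 0 n z, OF a_pos] unfolding S_def by auto
  have det_hol: "(\<lambda>z. det (S m z)) holomorphic_on U"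
    by (simp only: det_2) (intro holomorphic_on_diff holomorphic_on_mult S_hol)
  define x where "x z = (S m z $ 2 $ 2 * p z - S m z $ 1 $ 2 * r z) / det (S m z)" for z
  define y where "y z = (S m z $ 1 $ 1 * r z - S m z $ 2 $ 1 * p z) / det (S m z)" for z
  have xy_hol: "x holomorphic_on U" "y holomorphic_on U"
    unfolding x_def[abs_def] y_def[abs_def]
    by (intro holomorphic_on_divide holomorphic_on_diff holomorphic_on_mult S_hol hol det_hol det_nz)+
  define v where "v n z = S n z *v vector [x z, y z]" for n z
  have v_comp: "v n z $ i = S n z $ i $ 1 * x z + S n z $ i $ 2 * y z" for n z i
    by (simp add: v_def matrix_vector_mult_def sum_2)
  have v0: "v 0 z = vector [x z, y z]" for z
    by (simp add: v_def S_def)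
  have v_Suc: "v (Suc n) z = transfer a b n z *v v n z" for n z
    by (simp add: v_def S_def matrix_vector_mul_assoc)
  have v_Suc_1: "v (Suc n) z $ 1 = v n z $ 2" for n z
    by (simp only: v_comp S_def step_product_transfer_Suc)
  define u where "u n z = v n z $ 2" for n z
  have v_pair: "v n z = vector [u (n - 1) z, u n z]" if "n \<noteq> 0" for n z
    using that v_Suc_1[of "n - 1" z] by (simp add: vec_eq_iff forall_2 u_def)
  have solves: "S m z $ 1 $ 1 * x z + S m z $ 1 $ 2 * y z = p z"
    "S m z $ 2 $ 1 * x z + S m z $ 2 $ 2 * y z = r z" for z
  proof -
    have *: "det (S m z) * x z = S m z $ 2 $ 2 * p z - S m z $ 1 $ 2 * r z"
      "det (S m z) * y z = S m z $ 1 $ 1 * r z - S m z $ 2 $ 1 * p z"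
      using det_nz by (simp_all add: x_def y_def)
    have "det (S m z) * (S m z $ 1 $ 1 * x z + S m z $ 1 $ 2 * y z) = det (S m z) * p z"
      "det (S m z) * (S m z $ 2 $ 1 * x z + S m z $ 2 $ 2 * y z) = det (S m z) * r z"
      using * unfolding det_2 by algebra+
    then show "S m z $ 1 $ 1 * x z + S m z $ 1 $ 2 * y z = p z"
      "S m z $ 2 $ 1 * x z + S m z $ 2 $ 2 * y z = r z"
      using det_nz by simp_all
  qed
  have pm: "u (m - 1) z = p z" "u m z = r z" for z
  proof -
    have "v m z $ 1 = p z" "v m z $ 2 = r z" by (simp_all only: v_comp solves)
    moreover have "v m z $ 1 = u (m - 1) z" using v_pair[of m z] m by simp
    ultimately show "u (m - 1) z = p z" "u m z = r z" by (simp_all add: u_def)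
  qed
  show thesis
  proof (rule that[of u])
    show "u n holomorphic_on U" for n
      unfolding u_def[abs_def] v_comp by (intro holomorphic_on_add holomorphic_on_mult S_hol xy_hol)
    show "gen_eigenvector a b z (\<lambda>n. u n z)" if z: "z \<in> U" for z
      unfolding gen_eigenvector_def Let_def
    proof (intro exI conjI allI)
      show "vector [x z, y z] \<noteq> (0 :: complex^2)"
      proof
        assume "vector [x z, y z] = (0 :: complex^2)"
        then have "x z = 0" "y z = 0" by (simp_all add: vec_eq_iff forall_2)
        with solves[of z] nz[OF z] show False by simp
      qed
      fix n
      have "(if n = 0 then vector [x z, y z] else vector [u (n - 1) z, u n z]) = v n z"
        using v0 v_pair by simp
      then show "(if Suc n = 0 then vector [x z, y z] else vector [u (Suc n - 1) z, u (Suc n) z]) =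
          transfer a b n z *v (if n = 0 then vector [x z, y z] else vector [u (n - 1) z, u n z])"
        using v_pair[of "Suc n" z] v_Suc[of n z] by (simp only: if_False nat.distinct simp_thms)
    qed
    show "u (m - 1) z = p z" "u m z = r z" for z by (fact pm)+
  qed
qed

lemma gen_eigenvector_step:
  assumes "gen_eigenvector a b z u" "n \<ge> 1"
  shows "vector [u n, u (Suc n)] = transfer a b n z *v vector [u (n - 1), u n]"
proof -
  obtain \<eta> where "\<And>n. (if Suc n = 0 then \<eta> else vector [u (Suc n - 1), u (Suc n)]) =
      transfer a b n z *v (if n = 0 then \<eta> else vector [u (n - 1), u n])"
    using assms(1) unfolding gen_eigenvector_def Let_def by blast
  from this[of n] show ?thesis using assms(2) by simp
qed

lemma gen_eigenvector_recurrence: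
  assumes "gen_eigenvector a b z u" "n \<ge> 1"
  shows "u (Suc n) = - (of_real (if n = 0 then 1 else a (n - 1)) / of_real (a n)) * u (n - 1)
    + (z - of_real (b n)) / of_real (a n) * u n"
  using arg_cong[OF gen_eigenvector_step[OF assms], of "\<lambda>v. v $ 2"]
  by (simp add: transfer_def matrix_vector_mult_def sum_2)

lemma gen_eigenvector_step_product:
  assumes "gen_eigenvector a b z u" "m \<ge> 1"
  shows "vector [u (m + k - 1), u (m + k)] = step_product (transfer a b) m k z *v vector [u (m - 1), u m]"
proof (induction k)
  case (Suc k)
  have "vector [u (m + k), u (Suc (m + k))] = transfer a b (m + k) z *v vector [u (m + k - 1), u (m + k)]"
    using assms by (intro gen_eigenvector_step) auto
  also have "\<dots> = step_product (transfer a b) m (Suc k) z *v vector [u (m - 1), u m]"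
    unfolding Suc by (simp add: matrix_vector_mul_assoc)
  finally show ?case by simp
qed simp

context modulated_jacobi
begin

text \<open>
  Along a residue class the coefficients of the three-term recurrence converge, so limits propagate
  from two consecutive indices to all later ones. The limiting recurrence is invertible because
  its coefficient \<open>\<alpha> (i - 1) / \<alpha> i\<close> does not vanish; hence no two consecutive limits vanish
  together.
\<close>

lemma limits_along_residue_classes:
  fixes u L :: "nat \<Rightarrow> complex \<Rightarrow> complex"
  assumes u: "\<And>z. z \<in> U \<Longrightarrow> gen_eigenvector a b z (\<lambda>n. u n z)"
    and lim: "uniform_limit U (\<lambda>k z. u (k * N - 1) z / L k z) f sequentially"
      "uniform_limit U (\<lambda>k z. u (k * N) z / L k z) g sequentially"
    and bdd: "bounded (f ` U)" "bounded (g ` U)"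
    and nz: "\<And>z. z \<in> U \<Longrightarrow> f z \<noteq> 0 \<or> g z \<noteq> 0"
  shows "\<exists>\<phi>. (\<forall>i. uniform_limit U (\<lambda>k z. u (k * N + i) z / L k z) (\<phi> i) sequentially) \<and>
    (\<forall>z\<in>U. \<forall>i. cmod (\<phi> i z) + cmod (\<phi> (i + 1) z) > 0)"
proof -
  define c where "c i = complex_of_real (\<alpha> (int i - 1) / \<alpha> (int i))" for i :: nat
  define d where "d i = complex_of_real ((0 - \<beta> (int i)) / \<alpha> (int i))" for i :: nat
  define w where "w i z = rec_nat (f z, g z) (\<lambda>i (x, y). (y, - c i * x + d i * y)) i" for i z
  define \<psi> where "\<psi> i z = fst (w i z)" for i z
  define \<phi> where "\<phi> i z = snd (w i z)" for i z
  have init: "\<psi> 0 = f" "\<phi> 0 = g" by (simp_all add: \<psi>_def \<phi>_def w_def fun_eq_iff)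
  have \<psi>_Suc: "\<psi> (Suc i) = \<phi> i" and \<phi>_Suc: "\<phi> (Suc i) = (\<lambda>z. - c i * \<psi> i z + d i * \<phi> i z)" for i
    by (simp_all add: \<psi>_def \<phi>_def w_def fun_eq_iff case_prod_beta)
  have bdd_const: "bounded ((\<lambda>z. x) ` U)" for x :: complex by (auto simp: image_constant_conv)
  (* psi i is the limit at offset i - 1, which for i = 0 lies in the preceding block *)
  have main: "uniform_limit U (\<lambda>k z. u (k * N + i - 1) z / L k z) (\<psi> i) sequentially \<and>
      uniform_limit U (\<lambda>k z. u (k * N + i) z / L k z) (\<phi> i) sequentially \<and>
      bounded (\<psi> i ` U) \<and> bounded (\<phi> i ` U) \<and> (\<forall>z\<in>U. \<psi> i z \<noteq> 0 \<or> \<phi> i z \<noteq> 0)" for i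
  proof (induction i)
    case 0
    show ?case using lim bdd nz by (simp add: init)
  next
    case (Suc i)
    define C where "C k = complex_of_real (if k * N + i = 0 then 1 else a (k * N + i - 1)) / of_real (a (k * N + i))" for k
    define D where "D k z = (z - complex_of_real (b (k * N + i))) / of_real (a (k * N + i))" for k z
    have C: "uniform_limit U (\<lambda>k _. C k) (\<lambda>_. c i) sequentially"
      unfolding C_def c_def by (rule uniformly_bv_limit[OF ratio_uniformly_bv])
    have D: "uniform_limit U D (\<lambda>_. d i) sequentially"
      unfolding D_def[abs_def] d_def by (rule uniformly_bv_limit[OF coefficient_uniformly_bv])
    have lim_Suc: "uniform_limit U (\<lambda>k z. - C k * (u (k * N + i - 1) z / L k z) + D k z * (u (k * N + i) z / L k z))
        (\<lambda>z. - c i * \<psi> i z + d i * \<phi> i z) sequentially"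
      using Suc by (intro uniform_limit_add uniform_lim_mult uniform_limit_uminus C D bdd_const) auto
    have "\<forall>\<^sub>F k in sequentially. \<forall>z\<in>U. u (k * N + Suc i) z / L k z =
        - C k * (u (k * N + i - 1) z / L k z) + D k z * (u (k * N + i) z / L k z)"
      using eventually_ge_at_top[of 1]
    proof eventually_elim
      case (elim k)
      have "k * N + i \<ge> 1" using elim N by (simp add: Suc_le_eq)
      show ?case
      proof
        fix z assume z: "z \<in> U"
        have "u (k * N + Suc i) z = - C k * u (k * N + i - 1) z + D k z * u (k * N + i) z"
          using gen_eigenvector_recurrence[OF u[OF z] \<open>k * N + i \<ge> 1\<close>] by (simp add: C_def D_def)
        then show "u (k * N + Suc i) z / L k z =
            - C k * (u (k * N + i - 1) z / L k z) + D k z * (u (k * N + i) z / L k z)"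
          by (simp add: add_divide_distrib diff_divide_distrib)
      qed
    qed
    then have "uniform_limit U (\<lambda>k z. u (k * N + Suc i) z / L k z) (\<phi> (Suc i)) sequentially"
      using lim_Suc unfolding \<phi>_Suc by (subst uniform_limit_cong) auto
    moreover have "bounded (\<phi> (Suc i) ` U)"
    proof -
      have "bounded ((\<lambda>z. - c i * \<psi> i z) ` U)" "bounded ((\<lambda>z. d i * \<phi> i z) ` U)"
        using Suc bounded_linear_image[OF _ bounded_linear_mult_right, of "\<psi> i ` U" "- c i"]
          bounded_linear_image[OF _ bounded_linear_mult_right, of "\<phi> i ` U" "d i"]
        by (simp_all add: image_image)
      then show ?thesis unfolding \<phi>_Suc by (rule bounded_plus_comp)
    qed
    moreover have "c i \<noteq> 0" by (simp add: c_def \<alpha>_nonzero)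
    ultimately show ?case using Suc by (auto simp: \<psi>_Suc \<phi>_Suc)
  qed
  have "\<phi> i z \<noteq> 0 \<or> \<phi> (i + 1) z \<noteq> 0" if "z \<in> U" for i z
    using main[of "Suc i"] that by (auto simp: \<psi>_Suc)
  then have "cmod (\<phi> i z) + cmod (\<phi> (i + 1) z) > 0" if "z \<in> U" for i z
    using that by (metis add_nonneg_pos add_pos_nonneg norm_ge_zero zero_less_norm_iff)
  with main show ?thesis by (intro exI[of _ \<phi>]) blast
qed

end

section \<open>Solutions following an eigenvalue\<close>

context dichotomy
begin

lemma holomorphic_M:
  assumes "j \<ge> M"
  shows "\<Lambda>p j holomorphic_on U" "\<Lambda>m j holomorphic_on U" "\<mu>p j holomorphic_on U" "\<mu>m j holomorphic_on U"
    "\<Delta> j holomorphic_on U" "q j holomorphic_on U"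
proof -
  show \<Lambda>: "\<Lambda>p j holomorphic_on U" "\<Lambda>m j holomorphic_on U"
    using eigenvalue_holomorphic Im_trace_M[OF assms] by auto
  have "\<Lambda>p j z \<noteq> 0" if "z \<in> U" for z
    using eigenvectors(5) Im_trace_M[OF assms that] Y12_M[OF assms that] .
  then show "q j holomorphic_on U" unfolding q_def[abs_def] by (intro holomorphic_on_divide \<Lambda>)
  show \<mu>: "\<mu>p j holomorphic_on U" "\<mu>m j holomorphic_on U"
    unfolding \<mu>p_def[abs_def] \<mu>m_def[abs_def] using Y12_M[OF assms]
    by (intro holomorphic_on_divide holomorphic_on_diff \<Lambda> Y_holomorphic; simp)+
  show "\<Delta> j holomorphic_on U" unfolding \<Delta>_def[abs_def] by (intro holomorphic_on_diff \<mu>)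
qed

lemma eigencoordinates_step:
  assumes "j \<ge> M" "z \<in> U"
  shows "Y j z $ 1 $ 1 * (x + y) + Y j z $ 1 $ 2 * (\<mu>p j z * x + \<mu>m j z * y) = \<Lambda>p j z * x + \<Lambda>m j z * y"
    "Y j z $ 2 $ 1 * (x + y) + Y j z $ 2 $ 2 * (\<mu>p j z * x + \<mu>m j z * y) =
      \<mu>p j z * (\<Lambda>p j z * x) + \<mu>m j z * (\<Lambda>m j z * y)"
proof -
  note ev = eigenvectors(1-4)[OF Im_trace_M[OF assms] Y12_M[OF assms]]
  have "Y j z $ 1 $ 1 * (x + y) + Y j z $ 1 $ 2 * (\<mu>p j z * x + \<mu>m j z * y) =
      (Y j z $ 1 $ 1 + Y j z $ 1 $ 2 * \<mu>p j z) * x + (Y j z $ 1 $ 1 + Y j z $ 1 $ 2 * \<mu>m j z) * y"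
    by (simp add: algebra_simps)
  then show "Y j z $ 1 $ 1 * (x + y) + Y j z $ 1 $ 2 * (\<mu>p j z * x + \<mu>m j z * y) = \<Lambda>p j z * x + \<Lambda>m j z * y"
    by (simp only: ev)
  have "Y j z $ 2 $ 1 * (x + y) + Y j z $ 2 $ 2 * (\<mu>p j z * x + \<mu>m j z * y) =
      (Y j z $ 2 $ 1 + Y j z $ 2 $ 2 * \<mu>p j z) * x + (Y j z $ 2 $ 1 + Y j z $ 2 $ 2 * \<mu>m j z) * y"
    by (simp add: algebra_simps)
  then show "Y j z $ 2 $ 1 * (x + y) + Y j z $ 2 $ 2 * (\<mu>p j z * x + \<mu>m j z * y) =
      \<mu>p j z * (\<Lambda>p j z * x) + \<mu>m j z * (\<Lambda>m j z * y)"
    by (simp only: ev) (simp add: mult_ac)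
qed

text \<open>
  A solution is written as \<open>\<Prod> l j\<close> times the vector with coordinates \<open>(x k, y k)\<close> in the eigenbasis
  of the \<open>(k + M)\<close>-th block, where \<open>l\<close> is the eigenvalue used for normalization. The two step
  equations say that \<open>(x, y)\<close> evolves so that the vectors are mapped to each other by the block
  matrices. As the eigenbases converge to linearly independent vectors, the limits of the
  coordinates give those of the solution.
\<close>

lemma solution_asymptotics:
  fixes x y l :: "nat \<Rightarrow> complex \<Rightarrow> complex"
  assumes l_nz: "\<And>j z. j \<ge> M \<Longrightarrow> z \<in> U \<Longrightarrow> l j z \<noteq> 0"
    and hol: "x 0 holomorphic_on U" "y 0 holomorphic_on U"
    and init: "\<And>z. z \<in> U \<Longrightarrow> x 0 z \<noteq> 0 \<or> y 0 z \<noteq> 0"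
    and sum: "\<And>k z. z \<in> U \<Longrightarrow> \<Lambda>p (k + M) z * x k z + \<Lambda>m (k + M) z * y k z = l (k + M) z * (x (Suc k) z + y (Suc k) z)"
    and slope: "\<And>k z. z \<in> U \<Longrightarrow> \<mu>p (k + M) z * (\<Lambda>p (k + M) z * x k z) + \<mu>m (k + M) z * (\<Lambda>m (k + M) z * y k z)
       = l (k + M) z * (\<mu>p (Suc k + M) z * x (Suc k) z + \<mu>m (Suc k + M) z * y (Suc k) z)"
    and lim: "uniform_limit U x \<xi> sequentially" "uniform_limit U y \<eta> sequentially"
    and bdd: "bounded (\<xi> ` U)" "bounded (\<eta> ` U)"
    and lim_nz: "\<And>z. z \<in> U \<Longrightarrow> \<xi> z \<noteq> 0 \<or> \<eta> z \<noteq> 0"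
  shows "\<exists>u \<phi>. (\<forall>n. u n holomorphic_on U) \<and> (\<forall>z\<in>U. gen_eigenvector a b z (\<lambda>n. u n z)) \<and>
    (\<forall>z\<in>U. u (M * N - 1) z = x 0 z + y 0 z \<and> u (M * N) z = \<mu>p M z * x 0 z + \<mu>m M z * y 0 z) \<and>
    (\<forall>i. uniform_limit U (\<lambda>k z. u (k * N + i) z / (\<Prod>j = M..<k. l j z)) (\<phi> i) sequentially) \<and>
    (\<forall>z\<in>U. \<forall>i. cmod (\<phi> i z) + cmod (\<phi> (i + 1) z) > 0)"
proof -
  have injective: "s = 0 \<and> t = 0" if "s + t = 0" "m1 * s + m2 * t = 0" "m2 - m1 \<noteq> 0" for s t m1 m2 :: complex
  proof -
    have "(m2 - m1) * t = 0" using that(1,2) by algebra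
    with that(1,3) show ?thesis by simp
  qed
  have MN: "M * N \<ge> 1" using M N by simp
  have \<mu>_hol: "(\<lambda>z. \<mu>p M z * x 0 z + \<mu>m M z * y 0 z) holomorphic_on U"
    "(\<lambda>z. x 0 z + y 0 z) holomorphic_on U"
    by (intro holomorphic_on_add holomorphic_on_mult hol holomorphic_M order_refl)+
  have start: "x 0 z + y 0 z \<noteq> 0 \<or> \<mu>p M z * x 0 z + \<mu>m M z * y 0 z \<noteq> 0" if z: "z \<in> U" for z
    using injective[of "x 0 z" "y 0 z" "\<mu>p M z" "\<mu>m M z"] init[OF z] \<Delta>_M[OF order_refl z] by (auto simp: \<Delta>_def)
  obtain u where u: "\<And>n. u n holomorphic_on U" "\<And>z. z \<in> U \<Longrightarrow> gen_eigenvector a b z (\<lambda>n. u n z)"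
    "\<And>z. z \<in> U \<Longrightarrow> u (M * N - 1) z = x 0 z + y 0 z"
    "\<And>z. z \<in> U \<Longrightarrow> u (M * N) z = \<mu>p M z * x 0 z + \<mu>m M z * y 0 z"
    using prescribed_eigenvector[of a "M * N" _ U _ b, OF a_pos MN \<mu>_hol(2,1) start] by metis
  define L where "L k z = (\<Prod>j = M..<k. l j z)" for k z
  have L_nz: "L k z \<noteq> 0" if "z \<in> U" for k z
    unfolding L_def using l_nz that by simp
  have L_Suc: "L (Suc k + M) z = L (k + M) z * l (k + M) z" for k z
    unfolding L_def by (simp add: prod.atLeastLessThan_Suc)
  have rep: "u ((k + M) * N - 1) z = L (k + M) z * (x k z + y k z) \<and>
      u ((k + M) * N) z = L (k + M) z * (\<mu>p (k + M) z * x k z + \<mu>m (k + M) z * y k z)" if z: "z \<in> U" for k z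
  proof (induction k)
    case 0
    show ?case using u(3,4)[OF z] by (simp add: L_def)
  next
    case (Suc k)
    have "(k + M) * N \<ge> 1" using M N by simp
    from gen_eigenvector_step_product[OF u(2)[OF z] this, of N]
    have "vector [u ((Suc k + M) * N - 1) z, u ((Suc k + M) * N) z]
        = Y (k + M) z *v vector [u ((k + M) * N - 1) z, u ((k + M) * N) z]"
      unfolding Y_def monodromy_def by (simp add: add_ac)
    from arg_cong[OF this, of "\<lambda>v. v $ 1"] arg_cong[OF this, of "\<lambda>v. v $ 2"]
    have 1: "u ((Suc k + M) * N - 1) z = Y (k + M) z $ 1 $ 1 * u ((k + M) * N - 1) z + Y (k + M) z $ 1 $ 2 * u ((k + M) * N) z"
      and 2: "u ((Suc k + M) * N) z = Y (k + M) z $ 2 $ 1 * u ((k + M) * N - 1) z + Y (k + M) z $ 2 $ 2 * u ((k + M) * N) z"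
      by (simp_all add: matrix_vector_mult_def sum_2)
    note step = eigencoordinates_step[of "k + M" z "x k z" "y k z", OF _ z]
    have "u ((Suc k + M) * N - 1) z = L (k + M) z * (\<Lambda>p (k + M) z * x k z + \<Lambda>m (k + M) z * y k z)"
      unfolding 1 step(1)[symmetric, OF le_add2] using Suc by (simp add: algebra_simps)
    moreover have "u ((Suc k + M) * N) z
        = L (k + M) z * (\<mu>p (k + M) z * (\<Lambda>p (k + M) z * x k z) + \<mu>m (k + M) z * (\<Lambda>m (k + M) z * y k z))"
      unfolding 2 step(2)[symmetric, OF le_add2] using Suc by (simp add: algebra_simps)
    ultimately show ?case unfolding L_Suc sum[OF z] slope[OF z] by (simp add: mult.assoc)
  qed
  have \<mu>_lim: "uniform_limit U (\<lambda>k. \<mu>p (k + M)) (\<lambda>_. \<mu>p_lim) sequentially"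
    "uniform_limit U (\<lambda>k. \<mu>m (k + M)) (\<lambda>_. \<mu>m_lim) sequentially"
    by (rule uniform_limit_shift_iff[THEN iffD2, OF uniformly_bv_limit],
        rule \<mu>p_uniformly_bv \<mu>m_uniformly_bv)+
  have bdd_const: "bounded ((\<lambda>z. c) ` U)" for c :: complex by (auto simp: image_constant_conv)
  have bdd_mult: "bounded ((\<lambda>z. c * f z) ` U)" if "bounded (f ` U)" for c :: complex and f
    using bounded_linear_image[OF that bounded_linear_mult_right, of c] by (simp add: image_image)
  have "uniform_limit U (\<lambda>k z. x k z + y k z) (\<lambda>z. \<xi> z + \<eta> z) sequentially"
    by (intro uniform_limit_add lim)
  moreover have "u ((k + M) * N - 1) z / L (k + M) z = x k z + y k z" if "z \<in> U" for k z
    using rep[OF that, of k] L_nz[OF that] by simp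
  ultimately have "uniform_limit U (\<lambda>k z. u ((k + M) * N - 1) z / L (k + M) z) (\<lambda>z. \<xi> z + \<eta> z) sequentially"
    by (subst uniform_limit_cong'[where g = "\<lambda>k z. x k z + y k z" and i = "\<lambda>z. \<xi> z + \<eta> z"]) auto
  then have lim1: "uniform_limit U (\<lambda>k z. u (k * N - 1) z / L k z) (\<lambda>z. \<xi> z + \<eta> z) sequentially"
    by (rule uniform_limit_shift_iff[THEN iffD1])
  have "uniform_limit U (\<lambda>k z. \<mu>p (k + M) z * x k z + \<mu>m (k + M) z * y k z)
      (\<lambda>z. \<mu>p_lim * \<xi> z + \<mu>m_lim * \<eta> z) sequentially"
    by (intro uniform_limit_add uniform_lim_mult lim \<mu>_lim bdd bdd_const)
  moreover have "u ((k + M) * N) z / L (k + M) z = \<mu>p (k + M) z * x k z + \<mu>m (k + M) z * y k z" if "z \<in> U" for k z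
    using rep[OF that, of k] L_nz[OF that] by simp
  ultimately have "uniform_limit U (\<lambda>k z. u ((k + M) * N) z / L (k + M) z)
      (\<lambda>z. \<mu>p_lim * \<xi> z + \<mu>m_lim * \<eta> z) sequentially"
    by (subst uniform_limit_cong'[where g = "\<lambda>k z. \<mu>p (k + M) z * x k z + \<mu>m (k + M) z * y k z"
          and i = "\<lambda>z. \<mu>p_lim * \<xi> z + \<mu>m_lim * \<eta> z"]) auto
  then have lim2: "uniform_limit U (\<lambda>k z. u (k * N) z / L k z) (\<lambda>z. \<mu>p_lim * \<xi> z + \<mu>m_lim * \<eta> z) sequentially"
    by (rule uniform_limit_shift_iff[THEN iffD1])
  have "\<xi> z + \<eta> z \<noteq> 0 \<or> \<mu>p_lim * \<xi> z + \<mu>m_lim * \<eta> z \<noteq> 0" if "z \<in> U" for z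
    using injective[OF _ _ \<Delta>_limit(2), of "\<xi> z" "\<eta> z"] lim_nz[OF that] by blast
  then obtain \<phi> where "\<forall>i. uniform_limit U (\<lambda>k z. u (k * N + i) z / L k z) (\<phi> i) sequentially"
    "\<forall>z\<in>U. \<forall>i. cmod (\<phi> i z) + cmod (\<phi> (i + 1) z) > 0"
    using limits_along_residue_classes[OF u(2) lim1 lim2
        bounded_plus_comp[OF bdd] bounded_plus_comp[OF bdd_mult[OF bdd(1)] bdd_mult[OF bdd(2)]]] by blast
  with u show ?thesis
    by (intro exI[of _ u] exI[of _ \<phi>]) (simp add: L_def)
qed

lemma quotient_le: "cmod d \<le> c * cmod D \<Longrightarrow> D \<noteq> 0 \<Longrightarrow> cmod (d / D) \<le> c"
  by (simp add: norm_divide divide_le_eq)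

lemma shifted_e: "e (k + M) \<ge> 0" "summable (\<lambda>k. e (k + M))"
  using e_M(1) e_M(2) by (auto intro: summable_ignore_initial_segment)

text \<open>
  Passing from one eigenbasis to the next one subtracts from the first coordinate, and adds to the
  second one, the same quantity: the increments of the slopes, paired with the coordinates, and
  divided by the determinant of the new basis.
\<close>

lemma dominant_eigenvector:
  "\<exists>u \<phi>. (\<forall>n. u n holomorphic_on U) \<and> (\<forall>z\<in>U. gen_eigenvector a b z (\<lambda>n. u n z)) \<and>
    (\<forall>z\<in>U. u (M * N - 1) z = 1 \<and> u (M * N) z = \<mu>p M z) \<and>
    (\<forall>i. uniform_limit U (\<lambda>k z. u (k * N + i) z / (\<Prod>j = M..<k. \<Lambda>p j z)) (\<phi> i) sequentially) \<and>
    (\<forall>z\<in>U. \<forall>i. cmod (\<phi> i z) + cmod (\<phi> (i + 1) z) > 0)"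
proof -
  define A where "A k z = (\<mu>p (k + M) z - \<mu>p (Suc k + M) z) / \<Delta> (Suc k + M) z" for k z
  define B where "B k z = (\<mu>m (k + M) z - \<mu>m (Suc k + M) z) / \<Delta> (Suc k + M) z" for k z
  define w where "w k z = rec_nat (1, 0) (\<lambda>k (x, y).
     (x - (A k z * x + B k z * (q (k + M) z * y)), q (k + M) z * y + (A k z * x + B k z * (q (k + M) z * y)))) k" for k z
  define x where "x k z = fst (w k z)" for k z
  define y where "y k z = snd (w k z)" for k z
  have x0: "x 0 = (\<lambda>_. 1)" and y0: "y 0 = (\<lambda>_. 0)" by (simp_all add: x_def y_def w_def fun_eq_iff)
  have x_Suc: "x (Suc k) z = x k z - (A k z * x k z + B k z * (q (k + M) z * y k z))"
    and y_Suc: "y (Suc k) z = q (k + M) z * y k z + (A k z * x k z + B k z * (q (k + M) z * y k z))" for k z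
    by (simp_all add: x_def y_def w_def case_prod_beta)
  have ns: "\<not> summable (\<lambda>k. \<delta> (k + M))" using \<delta>_M(3) by (simp add: summable_iff_shift)
  have AB: "cmod (A k z) \<le> e (k + M)" "cmod (B k z) \<le> e (k + M)" if "z \<in> U" for k z
    unfolding A_def B_def using that \<mu>_M(3,4)[of "k + M" z] \<Delta>_M[of "Suc k + M" z] by (auto intro!: quotient_le)
  obtain \<xi> where \<xi>: "uniform_limit U x \<xi> sequentially" "\<forall>z\<in>U. cmod (\<xi> z - 1) \<le> 1/4"
    "uniform_limit U y (\<lambda>_. 0) sequentially"
    using dominant_solution[where U = U and e = "\<lambda>k. e (k + M)" and \<delta> = "\<lambda>k. \<delta> (k + M)" and q = "\<lambda>k. q (k + M)"
        and A = A and B = B and x = x and y = y, OF shifted_e e_M(3) _ _ ns q_M AB] \<delta>_M(1,2) x_Suc y_Suc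
    by (auto simp: x0 y0)
  have lp: "\<Lambda>p j z \<noteq> 0" if "j \<ge> M" "z \<in> U" for j z
    using eigenvectors(5) Im_trace_M[OF that] Y12_M[OF that] .
  have "\<exists>u \<phi>. (\<forall>n. u n holomorphic_on U) \<and> (\<forall>z\<in>U. gen_eigenvector a b z (\<lambda>n. u n z)) \<and>
    (\<forall>z\<in>U. u (M * N - 1) z = x 0 z + y 0 z \<and> u (M * N) z = \<mu>p M z * x 0 z + \<mu>m M z * y 0 z) \<and>
    (\<forall>i. uniform_limit U (\<lambda>k z. u (k * N + i) z / (\<Prod>j = M..<k. \<Lambda>p j z)) (\<phi> i) sequentially) \<and>
    (\<forall>z\<in>U. \<forall>i. cmod (\<phi> i z) + cmod (\<phi> (i + 1) z) > 0)"
  proof (rule solution_asymptotics[OF lp _ _ _ _ _ \<xi>(1,3)])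
    show "x 0 holomorphic_on U" "y 0 holomorphic_on U" by (simp_all add: x0 y0)
    show "x 0 z \<noteq> 0 \<or> y 0 z \<noteq> 0" for z by (simp add: x0)
    show "bounded (\<xi> ` U)"
    proof (rule boundedI)
      fix v assume "v \<in> \<xi> ` U"
      then have "cmod (v - 1) \<le> 1/4" using \<xi>(2) by auto
      then show "cmod v \<le> 5/4" using norm_triangle_ineq2[of v 1] by simp
    qed
    show "bounded ((\<lambda>_. 0 :: complex) ` U)" by (auto simp: image_constant_conv)
    show "\<xi> z \<noteq> 0 \<or> (0 :: complex) \<noteq> 0" if "z \<in> U" for z using \<xi>(2) that by force
  next
    fix k z assume z: "z \<in> U"
    have qm: "\<Lambda>p (k + M) z * q (k + M) z = \<Lambda>m (k + M) z"
      using lp[of "k + M" z] z by (simp add: q_def)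
    show "\<Lambda>p (k + M) z * x k z + \<Lambda>m (k + M) z * y k z = \<Lambda>p (k + M) z * (x (Suc k) z + y (Suc k) z)"
      unfolding x_Suc y_Suc qm[symmetric] by (simp add: algebra_simps)
    define \<rho> where "\<rho> = A k z * x k z + B k z * (q (k + M) z * y k z)"
    have "\<Delta> (Suc k + M) z \<noteq> 0" using \<Delta>_M z by simp
    then have "\<Delta> (Suc k + M) z * \<rho> = (\<mu>p (k + M) z - \<mu>p (Suc k + M) z) * x k z
        + (\<mu>m (k + M) z - \<mu>m (Suc k + M) z) * (q (k + M) z * y k z)"
      unfolding \<rho>_def A_def B_def by (simp add: distrib_left)
    then have "\<mu>p (Suc k + M) z * (x k z - \<rho>) + \<mu>m (Suc k + M) z * (q (k + M) z * y k z + \<rho>)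
        = \<mu>p (k + M) z * x k z + \<mu>m (k + M) z * (q (k + M) z * y k z)"
      unfolding \<Delta>_def by algebra
    then show "\<mu>p (k + M) z * (\<Lambda>p (k + M) z * x k z) + \<mu>m (k + M) z * (\<Lambda>m (k + M) z * y k z)
        = \<Lambda>p (k + M) z * (\<mu>p (Suc k + M) z * x (Suc k) z + \<mu>m (Suc k + M) z * y (Suc k) z)"
      unfolding x_Suc y_Suc \<rho>_def[symmetric] qm[symmetric] by (simp only:) (simp add: algebra_simps)
  qed
  then show ?thesis by (simp add: x0 y0)
qed

text \<open>
  Backward in time the roles of the two bases are exchanged, and the determinant in the denominator
  is that of the earlier basis.
\<close>

lemma recessive_eigenvector:
  "\<exists>u \<phi> X0 Y0. (\<forall>n. u n holomorphic_on U) \<and> (\<forall>z\<in>U. gen_eigenvector a b z (\<lambda>n. u n z)) \<and>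
    (\<forall>z\<in>U. Y0 z \<noteq> 0 \<and> u (M * N - 1) z = X0 z + Y0 z \<and> u (M * N) z = \<mu>p M z * X0 z + \<mu>m M z * Y0 z) \<and>
    (\<forall>i. uniform_limit U (\<lambda>k z. u (k * N + i) z / (\<Prod>j = M..<k. \<Lambda>m j z)) (\<phi> i) sequentially) \<and>
    (\<forall>z\<in>U. \<forall>i. cmod (\<phi> i z) + cmod (\<phi> (i + 1) z) > 0)"
proof -
  define A where "A k z = (\<mu>p (k + M) z - \<mu>p (Suc k + M) z) / \<Delta> (k + M) z" for k z
  define B where "B k z = (\<mu>m (k + M) z - \<mu>m (Suc k + M) z) / \<Delta> (k + M) z" for k z
  have A: "cmod (A k z) \<le> e (k + M)" and B: "cmod (B k z) \<le> e (k + M)" if "z \<in> U" for k z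
    unfolding A_def B_def using that \<mu>_M(1,2)[of "k + M" z] \<Delta>_M[of "k + M" z] by (auto intro!: quotient_le)
  have q: "cmod (q (k + M) z) \<le> 1" if "z \<in> U" for k z
    using q_M[of "k + M" z] \<delta>_M(1)[of "k + M"] that by simp
  have hol: "A k holomorphic_on U" "B k holomorphic_on U" for k
    unfolding A_def[abs_def] B_def[abs_def] using \<Delta>_M
    by (intro holomorphic_on_divide holomorphic_on_diff holomorphic_M; simp)+
  obtain x y where
    x: "\<And>k z. z \<in> U \<Longrightarrow> x k z = q (k + M) z * (x (Suc k) z + (A k z * x (Suc k) z + B k z * y (Suc k) z))"
    and y: "\<And>k z. z \<in> U \<Longrightarrow> y k z = y (Suc k) z - (A k z * x (Suc k) z + B k z * y (Suc k) z)"
    and lim: "uniform_limit U x (\<lambda>_. 0) sequentially" "uniform_limit U y (\<lambda>_. 1) sequentially"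
    and y_nz: "\<And>z. z \<in> U \<Longrightarrow> y 0 z \<noteq> 0"
    and hol_xy: "\<And>k. x k holomorphic_on U" "\<And>k. y k holomorphic_on U"
    using recessive_solution[where U = U and e = "\<lambda>k. e (k + M)" and q = "\<lambda>k. q (k + M)"
        and A = A and B = B, OF open_U shifted_e e_M(3) q A B holomorphic_M(6)[OF le_add2] hol] by blast
  have lm: "\<Lambda>m j z \<noteq> 0" and lp: "\<Lambda>p j z \<noteq> 0" if "j \<ge> M" "z \<in> U" for j z
    using eigenvectors(5,6) Im_trace_M[OF that] Y12_M[OF that] by blast+
  have "\<exists>u \<phi>. (\<forall>n. u n holomorphic_on U) \<and> (\<forall>z\<in>U. gen_eigenvector a b z (\<lambda>n. u n z)) \<and>
    (\<forall>z\<in>U. u (M * N - 1) z = x 0 z + y 0 z \<and> u (M * N) z = \<mu>p M z * x 0 z + \<mu>m M z * y 0 z) \<and>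
    (\<forall>i. uniform_limit U (\<lambda>k z. u (k * N + i) z / (\<Prod>j = M..<k. \<Lambda>m j z)) (\<phi> i) sequentially) \<and>
    (\<forall>z\<in>U. \<forall>i. cmod (\<phi> i z) + cmod (\<phi> (i + 1) z) > 0)"
  proof (rule solution_asymptotics[OF lm hol_xy _ _ _ lim])
    show "x 0 z \<noteq> 0 \<or> y 0 z \<noteq> 0" if "z \<in> U" for z using y_nz[OF that] by blast
    show "bounded ((\<lambda>_. 0 :: complex) ` U)" "bounded ((\<lambda>_. 1 :: complex) ` U)" by (auto simp: image_constant_conv)
    show "(0 :: complex) \<noteq> 0 \<or> (1 :: complex) \<noteq> 0" by simp
  next
    fix k z assume z: "z \<in> U"
    have qm: "\<Lambda>p (k + M) z * q (k + M) z = \<Lambda>m (k + M) z"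
      using lp[of "k + M" z] z by (simp add: q_def)
    define \<sigma> where "\<sigma> = A k z * x (Suc k) z + B k z * y (Suc k) z"
    have xk: "\<Lambda>p (k + M) z * x k z = \<Lambda>m (k + M) z * (x (Suc k) z + \<sigma>)"
      unfolding x[OF z, of k] \<sigma>_def[symmetric] qm[symmetric] by simp
    have yk: "y k z = y (Suc k) z - \<sigma>" unfolding y[OF z, of k] \<sigma>_def ..
    show "\<Lambda>p (k + M) z * x k z + \<Lambda>m (k + M) z * y k z = \<Lambda>m (k + M) z * (x (Suc k) z + y (Suc k) z)"
      unfolding xk yk by (simp add: algebra_simps)
    have "\<Delta> (k + M) z \<noteq> 0" using \<Delta>_M z by simp
    then have "\<Delta> (k + M) z * \<sigma> = (\<mu>p (k + M) z - \<mu>p (Suc k + M) z) * x (Suc k) z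
        + (\<mu>m (k + M) z - \<mu>m (Suc k + M) z) * y (Suc k) z"
      unfolding \<sigma>_def A_def B_def by (simp add: distrib_left)
    then show "\<mu>p (k + M) z * (\<Lambda>p (k + M) z * x k z) + \<mu>m (k + M) z * (\<Lambda>m (k + M) z * y k z)
        = \<Lambda>m (k + M) z * (\<mu>p (Suc k + M) z * x (Suc k) z + \<mu>m (Suc k + M) z * y (Suc k) z)"
      unfolding xk yk \<Delta>_def by algebra
  qed
  with y_nz show ?thesis by blast
qed

end

text \<open>
  At the block \<open>M\<close> the two solutions have the coordinates \<open>(1, 0)\<close> and \<open>(X0, Y0)\<close> with \<open>Y0 \<noteq> 0\<close> in
  the eigenbasis, so they are linearly independent.
\<close>

lemma (in oscillatory_jacobi) eigenvector_basis:
  "\<exists>M\<ge>1. \<exists>up um \<phi>p \<phi>m.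
      (\<forall>z\<in>U. gen_eigenvector_basis a b z (\<lambda>n. up n z) (\<lambda>n. um n z)) \<and>
      (\<forall>n. up n holomorphic_on U \<and> um n holomorphic_on U) \<and>
      (\<forall>i. uniform_limit U
             (\<lambda>k z. up (k * N + i) z / (\<Prod>j = M..<k. eig_plus (monodromy N a b (j * N) z))) (\<phi>p i) sequentially \<and>
           uniform_limit U
             (\<lambda>k z. um (k * N + i) z / (\<Prod>j = M..<k. eig_minus (monodromy N a b (j * N) z))) (\<phi>m i) sequentially) \<and>
      (\<forall>z\<in>U. \<forall>i. cmod (\<phi>p i z) + cmod (\<phi>p (i + 1) z) > 0 \<and> cmod (\<phi>m i z) + cmod (\<phi>m (i + 1) z) > 0)"
proof -
  obtain M e \<delta> where "dichotomy N a b \<alpha> \<beta> U c0 M e \<delta>"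
    using uniform_dichotomy by blast
  then interpret dichotomy N a b \<alpha> \<beta> U c0 M e \<delta> .
  obtain up \<phi>p where p: "\<forall>n. up n holomorphic_on U" "\<forall>z\<in>U. gen_eigenvector a b z (\<lambda>n. up n z)"
    "\<forall>z\<in>U. up (M * N - 1) z = 1 \<and> up (M * N) z = \<mu>p M z"
    "\<forall>i. uniform_limit U (\<lambda>k z. up (k * N + i) z / (\<Prod>j = M..<k. \<Lambda>p j z)) (\<phi>p i) sequentially"
    "\<forall>z\<in>U. \<forall>i. cmod (\<phi>p i z) + cmod (\<phi>p (i + 1) z) > 0"
    using dominant_eigenvector by blast
  obtain um \<phi>m X0 Y0 where m: "\<forall>n. um n holomorphic_on U" "\<forall>z\<in>U. gen_eigenvector a b z (\<lambda>n. um n z)"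
    "\<forall>z\<in>U. Y0 z \<noteq> 0 \<and> um (M * N - 1) z = X0 z + Y0 z \<and> um (M * N) z = \<mu>p M z * X0 z + \<mu>m M z * Y0 z"
    "\<forall>i. uniform_limit U (\<lambda>k z. um (k * N + i) z / (\<Prod>j = M..<k. \<Lambda>m j z)) (\<phi>m i) sequentially"
    "\<forall>z\<in>U. \<forall>i. cmod (\<phi>m i z) + cmod (\<phi>m (i + 1) z) > 0"
    using recessive_eigenvector by blast
  have indep: "lin_indep_pair (\<lambda>n. up n z) (\<lambda>n. um n z)" if z: "z \<in> U" for z
    unfolding lin_indep_pair_def
  proof (intro allI impI)
    fix c d assume *: "\<forall>n. c * up n z + d * um n z = 0"
    have Y0: "Y0 z \<noteq> 0" and \<Delta>: "\<mu>m M z - \<mu>p M z \<noteq> 0"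
      using m(3) z \<Delta>_M[of M z] by (auto simp: \<Delta>_def)
    have 1: "c * 1 + d * (X0 z + Y0 z) = 0" and 2: "c * \<mu>p M z + d * (\<mu>p M z * X0 z + \<mu>m M z * Y0 z) = 0"
      using *[rule_format, of "M * N - 1"] *[rule_format, of "M * N"] p(3) m(3) z by auto
    then have "d * ((\<mu>m M z - \<mu>p M z) * Y0 z) = 0" by algebra
    with Y0 \<Delta> have "d = 0" by simp
    with 1 show "c = 0 \<and> d = 0" by simp
  qed
  show ?thesis
    by (rule exI[of _ M], rule conjI[OF M], rule exI[of _ up], rule exI[of _ um],
        rule exI[of _ \<phi>p], rule exI[of _ \<phi>m])
      (use indep p m in \<open>simp add: gen_eigenvector_basis_def \<Lambda>p_def \<Lambda>m_def Y_def\<close>)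
qed

theorem theorem6p2:
  fixes N :: nat
    and a b :: "nat \<Rightarrow> real"
    and \<alpha> \<beta> :: "int \<Rightarrow> real"
    and K :: "complex set"
  assumes "N \<ge> 1"
    and "\<And>n. a n > 0"
    and "periodically_modulated N \<alpha> \<beta> a b"
    and "trace (periodic_monodromy N \<alpha> \<beta> 0 0) \<in> {-2<..<2}"
    and "bounded_variation_step N (\<lambda>n. a n / a (Suc n))"
    and "bounded_variation_step N (\<lambda>n. b (Suc n) / a (Suc n))"
    and "bounded_variation_step N (\<lambda>n. 1 / a (Suc n))"
    and "\<not> summable (\<lambda>n. 1 / a n)"
    and "compact K"
    and "K \<subseteq> half_plane
           (sgn (trace (vector_derivative (periodic_monodromy N \<alpha> \<beta> 0) (at 0))))"
  shows "\<exists>M\<ge>1. \<exists>(up :: nat \<Rightarrow> complex \<Rightarrow> complex) (um :: nat \<Rightarrow> complex \<Rightarrow> complex)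
            (\<phi>p :: nat \<Rightarrow> complex \<Rightarrow> complex) (\<phi>m :: nat \<Rightarrow> complex \<Rightarrow> complex).
      (\<forall>z\<in>K. gen_eigenvector_basis a b z (\<lambda>n. up n z) (\<lambda>n. um n z)) \<and>
      (\<forall>n. continuous_on K (up n) \<and> continuous_on K (um n) \<and>
           up n holomorphic_on interior K \<and> um n holomorphic_on interior K) \<and>
      (\<forall>i. uniform_limit K
             (\<lambda>k z. up (k * N + i) z / (\<Prod>j = M..<k. eig_plus (monodromy N a b (j * N) z)))
             (\<phi>p i) sequentially \<and>
           uniform_limit K
             (\<lambda>k z. um (k * N + i) z / (\<Prod>j = M..<k. eig_minus (monodromy N a b (j * N) z)))
             (\<phi>m i) sequentially) \<and>
      (\<forall>z\<in>K. \<forall>i<N.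
         cmod (\<phi>p i z) + cmod (\<phi>p (i + 1) z) > 0 \<and>
         cmod (\<phi>m i z) + cmod (\<phi>m (i + 1) z) > 0)"
proof (cases "K = {}")
  case True
  then show ?thesis by (intro exI[of _ "1 :: nat"] exI[of _ "\<lambda>_ _. 0"] conjI) auto
next
  case False
  define \<tau> where "\<tau> = trace (vector_derivative (periodic_monodromy N \<alpha> \<beta> 0) (at 0))"
  have pos: "\<tau> * Im z > 0" if "z \<in> K" for z
    using assms(10) that unfolding half_plane_def \<tau>_def[symmetric]
    by (auto simp: zero_less_mult_iff sgn_if split: if_splits)
  have cont: "continuous_on K (\<lambda>z. \<tau> * Im z)" by (intro continuous_intros)
  obtain z0 where z0: "z0 \<in> K" "\<And>z. z \<in> K \<Longrightarrow> \<tau> * Im z0 \<le> \<tau> * Im z"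
    using continuous_attains_inf[OF assms(9) False cont] by blast
  obtain R where R: "\<And>z. z \<in> K \<Longrightarrow> cmod z < R"
    using compact_imp_bounded[OF assms(9)] by (meson bounded_iff gt_ex order_le_less_trans)
  (* K is enclosed in an open set with the same uniform bounds, so that continuity on K and
     holomorphy on its interior both come from holomorphy on that set *)
  define c0 where "c0 = \<tau> * Im z0 / 2"
  define U where "U = ball 0 R \<inter> {z. c0 < \<tau> * Im z}"
  have c0: "c0 > 0" unfolding c0_def using pos[OF z0(1)] by simp
  have KU: "K \<subseteq> U"
  proof
    fix z assume z: "z \<in> K"
    have "c0 < \<tau> * Im z" using z0(2)[OF z] pos[OF z0(1)] by (simp add: c0_def)
    then show "z \<in> U" using R[OF z] by (simp add: U_def)
  qed
  have open_U: "open U"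
    unfolding U_def by (intro open_Int open_ball open_Collect_less continuous_intros)
  interpret oscillatory_jacobi N a b \<alpha> \<beta> U c0
  proof unfold_locales
    show "bounded U" unfolding U_def by (intro bounded_Int disjI1 bounded_ball)
    show "U \<noteq> {}" using KU False by blast
    show "c0 \<le> trace (vector_derivative (periodic_monodromy N \<alpha> \<beta> 0) (at 0)) * Im z" if "z \<in> U" for z
      using that by (simp add: U_def \<tau>_def)
  qed (use assms open_U c0 in auto)
  have int: "interior K \<subseteq> U" using KU interior_subset by blast
  obtain M up um \<phi>p \<phi>m where M: "M \<ge> 1"
      and basis: "\<forall>z\<in>U. gen_eigenvector_basis a b z (\<lambda>n. up n z) (\<lambda>n. um n z)"
      and hol: "\<forall>n. up n holomorphic_on U \<and> um n holomorphic_on U"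
      and lim: "\<forall>i. uniform_limit U
             (\<lambda>k z. up (k * N + i) z / (\<Prod>j = M..<k. eig_plus (monodromy N a b (j * N) z))) (\<phi>p i) sequentially \<and>
           uniform_limit U
             (\<lambda>k z. um (k * N + i) z / (\<Prod>j = M..<k. eig_minus (monodromy N a b (j * N) z))) (\<phi>m i) sequentially"
      and nz: "\<forall>z\<in>U. \<forall>i. cmod (\<phi>p i z) + cmod (\<phi>p (i + 1) z) > 0 \<and> cmod (\<phi>m i z) + cmod (\<phi>m (i + 1) z) > 0"
    using eigenvector_basis by blast
  show ?thesis
  proof (rule exI[of _ M], rule conjI[OF M], rule exI[of _ up], rule exI[of _ um],
      rule exI[of _ \<phi>p], rule exI[of _ \<phi>m], intro conjI)
    show "\<forall>z\<in>K. gen_eigenvector_basis a b z (\<lambda>n. up n z) (\<lambda>n. um n z)" using basis KU by blast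
    show "\<forall>n. continuous_on K (up n) \<and> continuous_on K (um n) \<and>
           up n holomorphic_on interior K \<and> um n holomorphic_on interior K"
      using hol KU int by (meson continuous_on_subset holomorphic_on_imp_continuous_on holomorphic_on_subset)
    show "\<forall>i. uniform_limit K
             (\<lambda>k z. up (k * N + i) z / (\<Prod>j = M..<k. eig_plus (monodromy N a b (j * N) z)))
             (\<phi>p i) sequentially \<and>
           uniform_limit K
             (\<lambda>k z. um (k * N + i) z / (\<Prod>j = M..<k. eig_minus (monodromy N a b (j * N) z)))
             (\<phi>m i) sequentially"
      using lim KU by (blast intro: uniform_limit_on_subset)
    show "\<forall>z\<in>K. \<forall>i<N. cmod (\<phi>p i z) + cmod (\<phi>p (i + 1) z) > 0 \<and>
         cmod (\<phi>m i z) + cmod (\<phi>m (i + 1) z) > 0"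
      using nz KU by blast
  qed
qed

end
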